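(* Let $m\in\{1,2,4\}$ and let $c>0$ be the constant described in the context. Let $\xi$ be a function such that $\xi(N)\to+\infty$ as $N\to+\infty$. Then \[ L^{1,z}\left(\tfrac12,1;\mathrm{St},\mathrm{Sym}^m;N\right)=L^{1,z}\left(\tfrac12,1;\mathrm{St},\mathrm{Sym}^m\right)[1+o_m(1)]\qquad(N\to+\infty) \] uniformly for all squarefree positive integers $N$ and complex numbers $z$ satisfying \[ P^-(N)\ \geq\ \xi(N)\max\left\{\omega(N),\ [(|z|+1)\omega(N)]^{2/3},\ (|z|+1)\omega(N)^{1/2}\right\} \] and \[ |z|\leq c\,\frac{\log(2N)}{\log_2(3N)\log_3(20N)}. \]
   Context: $\log_1=\log$, $\log_{n+1}=\log\circ\log_n$. $P^-(N)$ is the smallest prime divisor of $N$ ($P^-(1)=+\infty$), $\omega(N)$ the number of distinct prime divisors of $N$. $\mathrm{St}$ is the standard representation of $\mathrm{SU}(2)$ on $\mathbb{C}^2$ and $\mathrm{Sym}^m$ its $m$-th symmetric power; $D(X,\rho,g)=\det[I-X\rho(g)]^{-1}$ (a positive real number for $\rho=\mathrm{Sym}^m$, $X\in[0,1)$; complex powers use the real logarithm). $dg$ is the probability Haar measure. $\tau_z$ is defined by $\sum_n\tau_z(n)n^{-s}=\zeta(s)^z$, and $\square_N$ by $\sum_n\square_N(n)n^{-s}=\zeta_N(2s):=\prod_{p\mid N}(1-p^{-2s})^{-1}$. Set \[X_m^z(N)=\sum_{n\ge1}\frac{\tau_z(n)}{n^{m/2+1}}\sum_{q\ge1}\frac{\square_N(n^mq)}{q},\]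 \[L^{1,z}\left(\tfrac12,1;\mathrm{St},\mathrm{Sym}^m;N\right)=X_m^z(N)\prod_{p\nmid N}\int_{\mathrm{SU}(2)}D(p^{-1/2},\mathrm{St},g)D(p^{-1},\mathrm{Sym}^m,g)^z\,dg,\] \[L^{1,z}\left(\tfrac12,1;\mathrm{St},\mathrm{Sym}^m\right)=\prod_{p}\int_{\mathrm{SU}(2)}D(p^{-1/2},\mathrm{St},g)D(p^{-1},\mathrm{Sym}^m,g)^z\,dg.\] The constant $c$: it is a positive constant (depending on $m$) such that for some $\delta>0$, for all squarefree $N\ge1$ and all $z\in\mathbb{C}$ with $|z|\le c\log(2N)/[\log_2(3N)\log_3(20N)]$ one has \[\sum_{f}\omega^*(f)L(\tfrac12,f)L(1,\mathrm{Sym}^mf)^z=L^{1,z}\left(\tfrac12,1;\mathrm{St},\mathrm{Sym}^m;N\right)+O_m\left(\exp[-\delta\log(2N)/\log_2(3N)]\right),\] where $f$ runs over primitive forms of weight $2$ and level $N$ (trivial nebentypus), $\omega^*(f)=\frac{1}{4\pi(f,f)}\frac{N}{\varphi(N)}$ is the harmonic weight ($(f,f)$ the Petersson norm), $L(s,f)$ is normalised with critical strip $0\le\Re s\le1$ and $L(s,\mathrm{Sym}^m f)$ is the $m$-th symmetric power $L$-function. Such a constant exists. *)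

theory Defs
  imports
    "HOL-Complex_Analysis.Complex_Analysis"
    "HOL-Probability.Probability"
    "HOL-Number_Theory.Number_Theory"
    "HOL-Computational_Algebra.Squarefree"
    "Jordan_Normal_Form.Determinant"
begin

no_notation fps_nth (infixl "$" 75)
no_notation Matrix.vec_index (infixl "$" 100)

definition iter_log :: "nat \<Rightarrow> real \<Rightarrow> real" where
  "iter_log k = (ln :: real \<Rightarrow> real) ^^ k"

text \<open>The infimum of the empty set is \<open>\<infinity>\<close>, so that the value at 1 is \<open>\<infinity>\<close>.\<close>

definition P_minus :: "nat \<Rightarrow> ereal" where
  "P_minus N = (INF p\<in>prime_factors N. ereal (real p))"

definition omega :: "nat \<Rightarrow> nat" where
  "omega N = card (prime_factors N)"

text \<open>The coefficients of a Dirichlet series are determined by its values at real \<open>s > 1\<close>.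
  Restricting to real \<open>s\<close> makes the branch of \<open>\<zeta>(s)\<^sup>z\<close> unambiguous, as \<open>\<zeta>(s) > 0\<close>. The term of
  index 0 vanishes since \<open>0 powr x = 0\<close>.\<close>

definition dirichlet_coeffs :: "(real \<Rightarrow> complex) \<Rightarrow> nat \<Rightarrow> complex" where
  "dirichlet_coeffs F = (THE a. a 0 = 0 \<and>
     (\<forall>s>1. (\<lambda>n. a n * complex_of_real (real n powr (- s))) sums F s))"

definition zeta_real :: "real \<Rightarrow> real" where
  "zeta_real s = (\<Sum>n. real (Suc n) powr (- s))"

definition tau :: "complex \<Rightarrow> nat \<Rightarrow> complex" where
  "tau z = dirichlet_coeffs (\<lambda>s. complex_of_real (zeta_real s) powr z)"

definition zeta_N :: "nat \<Rightarrow> real \<Rightarrow> real" where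
  "zeta_N N s = (\<Prod>p\<in>prime_factors N. inverse (1 - real p powr (- s)))"

definition square_ind :: "nat \<Rightarrow> nat \<Rightarrow> complex" where
  "square_ind N = dirichlet_coeffs (\<lambda>s. complex_of_real (zeta_N N (2 * s)))"

definition SU2 :: "(complex^2^2) set" where
  "SU2 = {g. (\<chi> i j. cnj (g $ j $ i)) ** g = Finite_Cartesian_Product.mat 1
             \<and> Determinants.det g = 1}"

definition haar_SU2 :: "(complex^2^2) measure \<Rightarrow> bool" where
  "haar_SU2 \<mu> \<longleftrightarrow> prob_space \<mu> \<and> space \<mu> = SU2 \<and> sets \<mu> = sets (restrict_space borel SU2)
     \<and> (\<forall>h\<in>SU2. distr \<mu> \<mu> (\<lambda>g. h ** g) = \<mu>)"

definition std_rep :: "complex^2^2 \<Rightarrow> complex Matrix.mat" where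
  "std_rep g = mat_of_rows_list 2 [[g $ 1 $ 1, g $ 1 $ 2], [g $ 2 $ 1, g $ 2 $ 2]]"

text \<open>The matrix of the \<open>m\<close>-th symmetric power in the basis \<open>e\<^sub>1\<^sup>m\<^sup>-\<^sup>j e\<^sub>2\<^sup>j\<close>, \<open>0 \<le> j \<le> m\<close>. The \<open>j\<close>-th
  basis vector is sent to \<open>(g e\<^sub>1)\<^sup>m\<^sup>-\<^sup>j (g e\<^sub>2)\<^sup>j\<close>; homogeneous polynomials of degree \<open>m\<close> in
  \<open>e\<^sub>1, e\<^sub>2\<close> are written as polynomials in one variable by putting \<open>e\<^sub>1 = 1\<close>.\<close>

definition sym_rep :: "nat \<Rightarrow> complex^2^2 \<Rightarrow> complex Matrix.mat" where
  "sym_rep m g = Matrix.mat (m + 1) (m + 1) (\<lambda>(i, j).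
     Polynomial.coeff ([:g $ 1 $ 1, g $ 2 $ 1:] ^ (m - j) * [:g $ 1 $ 2, g $ 2 $ 2:] ^ j) i)"

definition DD :: "real \<Rightarrow> (complex^2^2 \<Rightarrow> complex Matrix.mat) \<Rightarrow> complex^2^2 \<Rightarrow> complex" where
  "DD X \<rho> g = inverse (Determinant.det
     (1\<^sub>m (dim_row (\<rho> g)) - complex_of_real X \<cdot>\<^sub>m \<rho> g))"

text \<open>The measure argument is meant to be the probability Haar measure on SU(2). The complex power
  \<open>powr\<close> is the principal one; its base is a positive real number here.\<close>

definition local_int :: "(complex^2^2) measure \<Rightarrow> nat \<Rightarrow> complex \<Rightarrow> nat \<Rightarrow> complex" where
  "local_int \<mu> m z p = (LINT g|\<mu>.
     DD (real p powr (- 1/2)) std_rep g * DD (1 / real p) (sym_rep m) g powr z)"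

definition X_factor :: "nat \<Rightarrow> complex \<Rightarrow> nat \<Rightarrow> complex" where
  "X_factor m z N = (\<Sum>\<^sub>\<infinity>n\<in>{1..}. tau z n / complex_of_real (real n powr (real m / 2 + 1)) *
     (\<Sum>\<^sub>\<infinity>q\<in>{1..}. square_ind N (n ^ m * q) / of_nat q))"

definition L_level :: "(complex^2^2) measure \<Rightarrow> nat \<Rightarrow> complex \<Rightarrow> nat \<Rightarrow> complex" where
  "L_level \<mu> m z N = X_factor m z N *
     (\<Prod>p. if prime p \<and> \<not> p dvd N then local_int \<mu> m z p else 1)"

definition L_limit :: "(complex^2^2) measure \<Rightarrow> nat \<Rightarrow> complex \<Rightarrow> complex" where
  "L_limit \<mu> m z = (\<Prod>p. if prime p then local_int \<mu> m z p else 1)"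

definition slash2 :: "int \<Rightarrow> int \<Rightarrow> int \<Rightarrow> int \<Rightarrow> (complex \<Rightarrow> complex) \<Rightarrow> complex \<Rightarrow> complex" where
  "slash2 a b c d f z =
     f ((of_int a * z + of_int b) / (of_int c * z + of_int d)) / (of_int c * z + of_int d) ^ 2"

text \<open>Cusp forms of weight 2 for \<open>\<Gamma>\<^sub>0(N)\<close>, extended by 0 outside the upper half plane so that
  distinct elements are distinct forms. At every cusp there is an expansion in powers of
  \<open>exp(2\<pi>iz/N)\<close>, because the width of each cusp divides \<open>N\<close>.\<close>

definition cusp_forms2 :: "nat \<Rightarrow> (complex \<Rightarrow> complex) set" where
  "cusp_forms2 N = {f.
     (\<forall>z. Im z \<le> 0 \<longrightarrow> f z = 0) \<and>
     f holomorphic_on {z. Im z > 0} \<and>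
     (\<forall>a b c d :: int. a * d - b * c = 1 \<and> int N dvd c \<longrightarrow>
        (\<forall>z. Im z > 0 \<longrightarrow> slash2 a b c d f z = f z)) \<and>
     (\<forall>a b c d :: int. a * d - b * c = 1 \<longrightarrow>
        (\<exists>u :: nat \<Rightarrow> complex. u 0 = 0 \<and> (\<forall>z. Im z > 0 \<longrightarrow>
           (\<lambda>n. u n * exp (2 * of_real pi * \<i> * of_nat n * z / of_nat N))
              sums slash2 a b c d f z)))}"

text \<open>The Ford fundamental domain of \<open>\<Gamma>\<^sub>0(N)\<close>: in the strip \<open>\<bar>Re z\<bar> \<le> 1/2\<close>, the points whose
  imaginary part is maximal in their orbit. Boundaries are null sets.\<close>

definition ford_domain :: "nat \<Rightarrow> complex set" where
  "ford_domain N = {z. Im z > 0 \<and> \<bar>Re z\<bar> \<le> 1/2 \<and>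
     (\<forall>c d :: int. int N dvd c \<and> coprime c d \<longrightarrow> 1 \<le> norm (of_int c * z + of_int d))}"

text \<open>In weight 2 the measure \<open>y\<^sup>2 dx dy / y\<^sup>2\<close> is Lebesgue measure. There is no division by the
  volume of the quotient.\<close>

definition petersson :: "nat \<Rightarrow> (complex \<Rightarrow> complex) \<Rightarrow> (complex \<Rightarrow> complex) \<Rightarrow> complex" where
  "petersson N f g = (LINT z:ford_domain N|lborel. f z * cnj (g z))"

definition hecke2 :: "nat \<Rightarrow> nat \<Rightarrow> (complex \<Rightarrow> complex) \<Rightarrow> complex \<Rightarrow> complex" where
  "hecke2 N n f z = (1 / of_nat n) * (\<Sum>a | a dvd n \<and> coprime a N. of_nat (a ^ 2) *
     (\<Sum>b<n div a. f ((of_nat a * z + of_nat b) / of_nat (n div a))))"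

definition fourier_coeff :: "(complex \<Rightarrow> complex) \<Rightarrow> nat \<Rightarrow> complex" where
  "fourier_coeff f n = integral {0..1}
     (\<lambda>x. f (Complex x 1) * exp (- 2 * of_real pi * \<i> * of_nat n * Complex x 1))"

text \<open>Normalised Hecke eigenforms in the orthogonal complement of the space of old forms.\<close>

definition primitive_forms2 :: "nat \<Rightarrow> (complex \<Rightarrow> complex) set" where
  "primitive_forms2 N = {f \<in> cusp_forms2 N.
     (\<forall>M d g. M * d dvd N \<and> M < N \<and> g \<in> cusp_forms2 M \<longrightarrow>
        petersson N f (\<lambda>z. g (of_nat d * z)) = 0) \<and>
     (\<forall>n\<ge>1. \<exists>l. \<forall>z. hecke2 N n f z = l * f z) \<and>
     fourier_coeff f 1 = 1}"

definition harmonic_weight :: "nat \<Rightarrow> (complex \<Rightarrow> complex) \<Rightarrow> complex" where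
  "harmonic_weight N f =
     1 / (4 * of_real pi * petersson N f f) * (of_nat N / of_nat (totient N))"

text \<open>Critical strip \<open>0 \<le> Re s \<le> 1\<close>, i.e. \<open>\<lambda>\<^sub>f(n) = a\<^sub>f(n) / n\<^sup>1\<^sup>/\<^sup>2\<close> in weight 2.\<close>

definition lam :: "(complex \<Rightarrow> complex) \<Rightarrow> nat \<Rightarrow> complex" where
  "lam f n = fourier_coeff f n / complex_of_real (sqrt (real n))"

definition entire_continuation :: "(complex \<Rightarrow> complex) \<Rightarrow> complex \<Rightarrow> complex" where
  "entire_continuation F = (THE G. G holomorphic_on UNIV \<and> (\<forall>s. Re s > 1 \<longrightarrow> G s = F s))"

definition L_form :: "(complex \<Rightarrow> complex) \<Rightarrow> complex \<Rightarrow> complex" where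
  "L_form f = entire_continuation (\<lambda>s. \<Sum>\<^sub>\<infinity>n\<in>{1..}. lam f n / of_nat n powr s)"

text \<open>Local parameters: the two roots of \<open>X\<^sup>2 - \<lambda>\<^sub>f(p) X + \<chi>(p)\<close>, with \<open>\<chi>\<close> the principal character
  modulo \<open>N\<close>. For \<open>p\<close> dividing \<open>N\<close> they are \<open>\<lambda>\<^sub>f(p)\<close> and 0 in some order, and the local factor of
  the symmetric power below is \<open>(1 - \<lambda>\<^sub>f(p)\<^sup>m p\<^sup>-\<^sup>s)\<^sup>-\<^sup>1\<close> (recall \<open>0 ^ 0 = 1\<close>), which is the correct
  one for squarefree \<open>N\<close>.\<close>

definition satake :: "nat \<Rightarrow> (complex \<Rightarrow> complex) \<Rightarrow> nat \<Rightarrow> complex \<times> complex" where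
  "satake N f p = (let l = lam f p; r = csqrt (l ^ 2 - 4 * (if p dvd N then 0 else 1))
     in ((l + r) / 2, (l - r) / 2))"

definition L_sym :: "nat \<Rightarrow> nat \<Rightarrow> (complex \<Rightarrow> complex) \<Rightarrow> complex \<Rightarrow> complex" where
  "L_sym N m f = entire_continuation (\<lambda>s. \<Prod>p. if prime p then
     (\<Prod>j\<le>m. inverse (1 - fst (satake N f p) ^ (m - j) * snd (satake N f p) ^ j
        * of_nat p powr (- s))) else 1)"

definition z_range :: "real \<Rightarrow> nat \<Rightarrow> complex set" where
  "z_range c N = {z. norm z \<le> c * (ln (2 * real N) /
     (iter_log 2 (3 * real N) * iter_log 3 (20 * real N)))}"

text \<open>The constants for which the twisted first moment of \<open>L(1/2, f)\<close> has the expected asymptotic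
  expansion.\<close>

definition moment_constant :: "(complex^2^2) measure \<Rightarrow> nat \<Rightarrow> real \<Rightarrow> bool" where
  "moment_constant \<mu> m c \<longleftrightarrow> c > 0 \<and>
     (\<exists>\<delta>>0. \<exists>K. \<forall>N\<ge>1. squarefree N \<longrightarrow> (\<forall>z\<in>z_range c N.
        norm ((\<Sum>f\<in>primitive_forms2 N.
                  harmonic_weight N f * L_form f (1/2) * L_sym N m f 1 powr z)
              - L_level \<mu> m z N)
          \<le> K * exp (- \<delta> * (ln (2 * real N) / iter_log 2 (3 * real N)))))"

end

theory Submission
  imports Defs
begin

text \<open>
  Both sides contain the same product of local integrals over the primes not dividing \<open>N\<close>. What
  remains is to compare \<open>X_factor m z N\<close> with the finite product of the local integrals over the
  primes dividing \<open>N\<close>, and both of these are \<open>1 + o(1)\<close>. Write \<open>P\<close> for the least prime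
  factor of \<open>N\<close>.

  For \<open>X_factor\<close>, the coefficients \<open>\<tau>\<^sub>z(n)\<close> and \<open>\<box>\<^sub>N(n)\<close> first have to be identified
  (\<open>tau_eq_gen_divisor\<close>, \<open>square_ind_eq\<close>). Since \<open>\<box>\<^sub>N(n\<^sup>m q)\<close> vanishes unless \<open>n\<close> and \<open>q\<close>
  are composed of primes dividing \<open>N\<close>, and \<open>\<bar>\<tau>\<^sub>z(n)\<bar>\<close> is at most the value at \<open>n\<close> of the same
  function with parameter \<open>\<bar>z\<bar>\<close>, the double sum is dominated by the product over \<open>p\<close> dividing
  \<open>N\<close> of \<open>(1 - p\<^sup>-\<^sup>3\<^sup>/\<^sup>2)\<^sup>-\<^sup>\<bar>\<^sup>z\<^sup>\<bar> (1 - p\<^sup>-\<^sup>1)\<^sup>-\<^sup>1\<close>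
  (\<open>norm_X_factor_minus_1_le\<close>). Its logarithm is of order at most
  \<open>\<bar>z\<bar> \<omega>(N) P\<^sup>-\<^sup>3\<^sup>/\<^sup>2 + \<omega>(N) P\<^sup>-\<^sup>1\<close>.

  For the local integrals, let \<open>t\<close> be the trace of \<open>g\<close>, \<open>\<chi>\<close> the trace of its symmetric power,
  and \<open>Y = 1/p\<close>. The two factors of the integrand are
  \<open>1 + t Y\<^sup>1\<^sup>/\<^sup>2 + (t\<^sup>2 - 1) Y + O(Y\<^sup>3\<^sup>/\<^sup>2)\<close> and \<open>1 + z \<chi> Y + O((1 + \<bar>z\<bar>)\<^sup>2 Y\<^sup>2)\<close>. The functions
  \<open>t\<close>, \<open>t\<^sup>2 - 1\<close> and \<open>\<chi>\<close> are nontrivial irreducible characters, so they integrate to zero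
  (\<open>haar_character_integrals\<close>), and the local integral is
  \<open>1 + O((1 + \<bar>z\<bar>) p\<^sup>-\<^sup>3\<^sup>/\<^sup>2 + (1 + \<bar>z\<bar>)\<^sup>2 p\<^sup>-\<^sup>2)\<close> (\<open>local_int_approx\<close>). For fixed \<open>z\<close> this
  is summable over \<open>p\<close>, which gives the convergence of the infinite products; summed over the
  primes dividing \<open>N\<close>, the error is of order at most
  \<open>(1 + \<bar>z\<bar>) \<omega>(N) P\<^sup>-\<^sup>3\<^sup>/\<^sup>2 + (1 + \<bar>z\<bar>)\<^sup>2 \<omega>(N) P\<^sup>-\<^sup>2\<close>.

  The three terms in the lower bound for \<open>P\<close> make \<open>\<omega>(N) P\<^sup>-\<^sup>1\<close>,
  \<open>(1 + \<bar>z\<bar>) \<omega>(N) P\<^sup>-\<^sup>3\<^sup>/\<^sup>2\<close> and \<open>(1 + \<bar>z\<bar>)\<^sup>2 \<omega>(N) P\<^sup>-\<^sup>2\<close> tend to zero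
  (\<open>prime_factor_terms_le\<close>).
\<close>

section \<open>Dirichlet coefficients and generalised divisor functions\<close>

text \<open>Multiply the series by \<open>k\<^sup>s\<close>, where \<open>k\<close> is the index of the first nonzero coefficient, and let
  \<open>s\<close> tend to infinity: all terms but the \<open>k\<close>-th tend to zero. Convergence at \<open>s = 2\<close> makes
  the coefficients \<open>O(n\<^sup>2)\<close>, so from \<open>s = 4\<close> on the tail is dominated by a summable sequence.\<close>
lemma dirichlet_series_zero_imp_coeff_zero:
  fixes a :: "nat \<Rightarrow> complex"
  assumes a0: "a 0 = 0"
    and sums: "\<And>s. s > 1 \<Longrightarrow> (\<lambda>n. a n * complex_of_real (real n powr (- s))) sums 0"
  shows "a n = 0"
proof (rule ccontr)
  assume "a n \<noteq> 0"
  define k where "k = (LEAST n. a n \<noteq> 0)"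
  have ak: "a k \<noteq> 0"
    unfolding k_def by (rule LeastI) (use \<open>a n \<noteq> 0\<close> in auto)
  have below: "a j = 0" if "j < k" for j
    using not_less_Least[of j "\<lambda>n. a n \<noteq> 0"] that by (auto simp: k_def)
  have k_pos: "k > 0" using ak a0 by (cases k) auto
  have "(\<lambda>n. a n * complex_of_real (real n powr (- 2))) \<longlonglongrightarrow> 0"
    using sums[of 2] by (intro summable_LIMSEQ_zero) (auto simp: sums_iff)
  then have "Bseq (\<lambda>n. a n * complex_of_real (real n powr (- 2)))"
    by (intro convergent_imp_Bseq) (auto simp: convergent_def)
  then obtain K where K: "K > 0" "\<And>n. norm (a n * complex_of_real (real n powr (- 2))) \<le> K"
    by (auto simp: Bseq_def)
  have bound: "norm (a n) * real n powr (-4) \<le> K * real n powr (-2)" for n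
  proof -
    have "norm (a n) * real n powr (-4) = norm (a n) * real n powr (-2) * real n powr (-2)"
      by (simp flip: powr_add)
    also have "\<dots> \<le> K * real n powr (-2)"
      using K(2)[of n] by (intro mult_right_mono) (auto simp: norm_mult)
    finally show ?thesis .
  qed
  \<comment> \<open>For \<open>n > k\<close> the ratio \<open>k/n\<close> is at most \<open>q < 1\<close>; this gives geometric decay in \<open>s = 4 + r\<close>.\<close>
  define q where "q = real k / real (Suc k)"
  have q: "0 < q" "q < 1" using k_pos by (auto simp: q_def)
  define f where "f = (\<lambda>(r::nat) n. a n * complex_of_real ((real n / real k) powr (- (4 + real r))))"
  define C where "C = (\<Sum>n. K * real k ^ 4 * real n powr (-2))"
  have summ: "summable (\<lambda>n. K * real k ^ 4 * real n powr (-2))"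
    by (intro summable_mult) (simp add: summable_real_powr_iff)
  have tail: "norm (f r n) \<le> q ^ r * (K * real k ^ 4 * real n powr (-2))" if "n \<noteq> k" for r n
  proof (cases "n < k")
    case True
    then show ?thesis using below q K by (auto simp: f_def)
  next
    case False
    then have nk: "n \<ge> Suc k" using that by simp
    have "(real n / real k) powr (- e) = (real k / real n) powr e" for e
      using nk k_pos by (simp add: powr_divide powr_minus field_simps)
    from this[of "4 + real r"]
    have "(real n / real k) powr (- (4 + real r)) = (real k / real n) powr real (4 + r)"
      by (simp only: of_nat_add of_nat_numeral)
    also have "\<dots> = (real k / real n) ^ (4 + r)"
      using nk k_pos by (subst powr_realpow) auto
    also have "\<dots> = real k ^ 4 * real n powr (-4) * (real k / real n) ^ r"
      using nk k_pos by (simp add: power_add power_divide powr_minus powr_realpow divide_inverse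
          power_mult_distrib power_inverse)
    finally have eq: "(real n / real k) powr (- (4 + real r))
        = real k ^ 4 * real n powr (-4) * (real k / real n) ^ r" .
    have "norm (f r n) = norm (a n) * (real k ^ 4 * real n powr (-4) * (real k / real n) ^ r)"
      unfolding f_def eq norm_mult norm_of_real by simp
    also have "\<dots> \<le> norm (a n) * (real k ^ 4 * real n powr (-4) * q ^ r)"
      using nk k_pos unfolding q_def
      by (intro mult_left_mono power_mono divide_left_mono) auto
    also have "\<dots> = q ^ r * real k ^ 4 * (norm (a n) * real n powr (-4))" by simp
    also have "\<dots> \<le> q ^ r * real k ^ 4 * (K * real n powr (-2))"
      using bound[of n] q by (intro mult_left_mono) auto
    finally show ?thesis by (simp add: mult_ac)
  qed
  have "norm (a k) \<le> q ^ r * C" for r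
  proof -
    have "f r sums 0"
    proof -
      have scale: "(\<lambda>n. complex_of_real (real k powr e) * (a n * complex_of_real (real n powr (- e))))
          = (\<lambda>n. a n * complex_of_real ((real n / real k) powr (- e)))" for e
      proof -
        have "real k powr e * real n powr (- e) = (real n / real k) powr (- e)" for n
          by (simp add: powr_divide powr_minus_divide)
        then show ?thesis by (simp flip: of_real_mult add: mult.left_commute[of "complex_of_real _"])
      qed
      have "(\<lambda>n. complex_of_real (real k powr (4 + real r)) *
          (a n * complex_of_real (real n powr (- (4 + real r))))) sums
          (complex_of_real (real k powr (4 + real r)) * 0)"
        by (intro sums_mult sums) auto
      also have "(\<lambda>n. complex_of_real (real k powr (4 + real r)) *
          (a n * complex_of_real (real n powr (- (4 + real r))))) = f r"
        unfolding f_def using scale[of "4 + real r"] by blast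
      finally show ?thesis by simp
    qed
    then have "(\<lambda>n. f r n - (if n = k then f r n else 0)) sums (0 - f r k)"
      by (intro sums_diff sums_single)
    moreover have "norm (f r n - (if n = k then f r n else 0))
        \<le> q ^ r * (K * real k ^ 4 * real n powr (-2))" for n
      using tail[of n r] q K by auto
    ultimately have "norm (0 - f r k) \<le> (\<Sum>n. q ^ r * (K * real k ^ 4 * real n powr (-2)))"
      using summable_mult[OF summ, of "q ^ r"]
      by (metis (no_types, lifting) norm_suminf_le sums_unique)
    also have "\<dots> = q ^ r * C" unfolding C_def by (intro suminf_mult summ)
    finally show ?thesis using k_pos by (simp add: f_def)
  qed
  moreover have "(\<lambda>r. q ^ r * C) \<longlonglongrightarrow> 0"
    using q by (intro tendsto_mult_left_zero LIMSEQ_power_zero) auto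
  ultimately have "norm (a k) \<le> 0"
    by (intro LIMSEQ_le_const[of "\<lambda>r. q ^ r * C"]) auto
  then show False using ak by simp
qed

lemma dirichlet_coeffs_eqI:
  assumes "a 0 = 0" "\<And>s. s > 1 \<Longrightarrow> (\<lambda>n. a n * complex_of_real (real n powr (- s))) sums F s"
  shows "dirichlet_coeffs F = a"
  unfolding dirichlet_coeffs_def
proof (rule the_equality)
  fix b assume b: "b 0 = 0 \<and> (\<forall>s>1. (\<lambda>n. b n * complex_of_real (real n powr (- s))) sums F s)"
  have "b n - a n = 0" for n
  proof (rule dirichlet_series_zero_imp_coeff_zero[of "\<lambda>n. b n - a n"])
    fix s :: real assume "s > 1"
    with assms b show "(\<lambda>n. (b n - a n) * complex_of_real (real n powr - s)) sums 0"
      using sums_diff[of _ "F s" _ "F s"] by (force simp: algebra_simps)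
  qed (use assms b in auto)
  then show "b = a" by auto
qed (use assms in auto)

definition smooth_numbers :: "nat set \<Rightarrow> nat set" where
  "smooth_numbers S = {n. n > 0 \<and> prime_factors n \<subseteq> S}"

text \<open>The coefficients of the formal Euler product of \<open>\<zeta>(s)\<^sup>z\<close>, since
  \<open>(1 - x)\<^sup>-\<^sup>z\<close> is the sum of \<open>pochhammer z k / k! x\<^sup>k\<close>. The value at 0 follows the convention
  for coefficients of Dirichlet series.\<close>
definition gen_divisor :: "'a::field_char_0 \<Rightarrow> nat \<Rightarrow> 'a" where
  "gen_divisor z n = (if n = 0 then 0 else
     \<Prod>p\<in>prime_factors n. pochhammer z (multiplicity p n) / fact (multiplicity p n))"

definition smooth_zeta :: "nat set \<Rightarrow> real \<Rightarrow> real" where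
  "smooth_zeta S s = (\<Prod>p\<in>S. inverse (1 - real p powr (- s)))"

lemma gen_divisor_1 [simp]: "gen_divisor 1 n = (if n = 0 then 0 else 1)"
  by (auto simp: gen_divisor_def simp flip: pochhammer_fact)

lemma gen_divisor_at_1 [simp]: "gen_divisor z (Suc 0) = 1"
  by (auto simp: gen_divisor_def)

lemma of_real_gen_divisor: "of_real (gen_divisor x n) = gen_divisor (of_real x :: complex) n"
  by (auto simp: gen_divisor_def pochhammer_of_real)

lemma norm_pochhammer_le: "norm (pochhammer (z::complex) k) \<le> pochhammer (norm z) k"
proof (induction k)
  case (Suc k)
  have "norm (z + of_nat k) \<le> norm z + real k"
    using norm_triangle_ineq[of z "of_nat k"] by simp
  then show ?case using Suc
    by (auto simp: pochhammer_Suc norm_mult pochhammer_prod[of "norm z"]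
        intro!: mult_mono prod_nonneg)
qed simp

lemma gen_divisor_nonneg: "x \<ge> 0 \<Longrightarrow> gen_divisor (x::real) n \<ge> 0"
  unfolding gen_divisor_def
  by (auto intro!: prod_nonneg divide_nonneg_pos simp: pochhammer_prod prod_nonneg)

lemma norm_gen_divisor_le: "norm (gen_divisor (z::complex) n) \<le> gen_divisor (norm z) n"
  unfolding gen_divisor_def
  by (auto simp: prod_norm[symmetric] norm_divide intro!: prod_mono divide_right_mono norm_pochhammer_le)

lemma gen_divisor_prime_power_mult:
  assumes "prime p" "\<not> p dvd n"
  shows "gen_divisor z (p ^ k * n) = pochhammer z k / fact k * gen_divisor z n"
proof -
  have n: "n > 0" using assms by (cases n) auto
  have p: "p > 0" using assms prime_gt_0_nat by blast
  have pn: "p \<notin> prime_factors n" using assms by auto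
  have mult: "multiplicity q (p ^ k * n) = multiplicity q n" if "q \<in> prime_factors n" for q
  proof -
    have "prime q" "q \<noteq> p" using that pn by auto
    then show ?thesis using n p assms
      by (subst prime_elem_multiplicity_mult_distrib) (auto simp: multiplicity_distinct_prime_power)
  qed
  have multp: "multiplicity p (p ^ k * n) = k"
    using assms n p
    by (subst prime_elem_multiplicity_mult_distrib)
       (auto simp: not_dvd_imp_multiplicity_0 multiplicity_prime_power)
  have pf: "prime_factors (p ^ k * n) = (if k = 0 then {} else {p}) \<union> prime_factors n"
    using n p assms
    by (cases k) (simp_all add: prime_factors_product prime_factors_power prime_prime_factors
        del: power_Suc)
  have "(\<Prod>q\<in>prime_factors n. pochhammer z (multiplicity q (p ^ k * n)) / fact (multiplicity q (p ^ k * n)))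
      = gen_divisor z n"
    using n by (auto simp: gen_divisor_def mult intro!: prod.cong)
  then show ?thesis using n p pn by (auto simp: gen_divisor_def[of z "p ^ k * n"] pf multp)
qed

lemma smooth_numbers_empty: "smooth_numbers {} = {1}"
  by (auto simp: smooth_numbers_def prime_factorization_empty_iff)

text \<open>Splitting off the full power of \<open>p\<close>: this is the combinatorial content of one factor of an Euler
  product.\<close>
lemma bij_betw_smooth_numbers_insert:
  assumes "prime p" "p \<notin> S"
  shows "bij_betw (\<lambda>(k, n). p ^ k * n) (UNIV \<times> smooth_numbers S) (smooth_numbers (insert p S))"
proof (rule bij_betwI)
  have p0: "p > 0" and p1: "p \<noteq> 1" using assms prime_gt_0_nat by auto
  have pn: "\<not> p dvd n" "n > 0" if "n \<in> smooth_numbers S" for n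
    using that assms by (auto simp: smooth_numbers_def prime_factors_dvd)
  show "(\<lambda>(k, n). p ^ k * n) \<in> UNIV \<times> smooth_numbers S \<rightarrow> smooth_numbers (insert p S)"
  proof
    fix y :: "nat \<times> nat" assume "y \<in> UNIV \<times> smooth_numbers S"
    then obtain k n where y: "y = (k, n)" "n > 0" "prime_factors n \<subseteq> S"
      by (auto simp: smooth_numbers_def)
    then show "(\<lambda>(k, n). p ^ k * n) y \<in> smooth_numbers (insert p S)"
      using assms p0
      by (cases k) (auto simp: smooth_numbers_def prime_factors_product prime_factors_power
        prime_prime_factors simp del: power_Suc)
  qed
  show "(\<lambda>n. (multiplicity p n, n div p ^ multiplicity p n)) \<in>
      smooth_numbers (insert p S) \<rightarrow> UNIV \<times> smooth_numbers S"
  proof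
    fix n assume n: "n \<in> smooth_numbers (insert p S)"
    define l where "l = n div p ^ multiplicity p n"
    have nl: "n = p ^ multiplicity p n * l"
      by (simp add: l_def multiplicity_dvd)
    have n0: "n > 0" using n by (auto simp: smooth_numbers_def)
    have "l > 0" using n0 nl by (metis gr0I mult_0_right)
    moreover have "l dvd n" using nl by (metis dvd_triv_right)
    then have "prime_factors l \<subseteq> insert p S"
      using n n0 dvd_prime_factors[of n l] by (auto simp: smooth_numbers_def)
    moreover have "\<not> p dvd l"
      unfolding l_def using n0 p1 assms by (intro multiplicity_decompose) auto
    then have "p \<notin> prime_factors l" by auto
    ultimately show "(multiplicity p n, n div p ^ multiplicity p n) \<in> UNIV \<times> smooth_numbers S"
      by (auto simp: smooth_numbers_def l_def)
  qed
  show "(multiplicity p (case x of (k, n) \<Rightarrow> p ^ k * n),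
      (case x of (k, n) \<Rightarrow> p ^ k * n) div p ^ multiplicity p (case x of (k, n) \<Rightarrow> p ^ k * n)) = x"
    if xU: "x \<in> UNIV \<times> smooth_numbers S" for x :: "nat \<times> nat"
  proof -
    obtain k n where x: "x = (k, n)" "n \<in> smooth_numbers S" using xU by auto
    have "multiplicity p (p ^ k * n) = k"
      using pn[OF x(2)] assms p0
      by (subst prime_elem_multiplicity_mult_distrib)
         (auto simp: not_dvd_imp_multiplicity_0 multiplicity_prime_power)
    then show ?thesis using x p0 by simp
  qed
  show "(case (multiplicity p n, n div p ^ multiplicity p n) of (k, n) \<Rightarrow> p ^ k * n) = n" for n
    by (simp add: multiplicity_dvd)
qed

lemma has_sum_mult_Times_complex:
  fixes f :: "'a \<Rightarrow> complex" and g :: "'b \<Rightarrow> complex"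
  assumes "(f has_sum x) A" "(g has_sum y) B"
  shows "((\<lambda>(a, b). f a * g b) has_sum x * y) (A \<times> B)"
proof (rule has_sum_SigmaI)
  have "(\<lambda>a. norm (f a)) summable_on A" "(\<lambda>b. norm (g b)) summable_on B"
    using assms by (auto simp: has_sum_iff simp flip: summable_on_iff_abs_summable_on_complex)
  then have "(\<lambda>(a, b). norm (f a) * norm (g b)) summable_on A \<times> B"
    by (intro summable_on_SigmaI[where g = "\<lambda>a. norm (f a) * infsum (\<lambda>b. norm (g b)) B"])
       (auto intro!: has_sum_cmult_right summable_on_cmult_left)
  then show "(\<lambda>(a, b). f a * g b) summable_on A \<times> B"
    by (subst summable_on_iff_abs_summable_on_complex) (simp add: case_prod_unfold norm_mult)
  show "((\<lambda>b. case (a, b) of (a, b) \<Rightarrow> f a * g b) has_sum f a * y) B" for a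
    by (auto intro!: has_sum_cmult_right assms)
  show "((\<lambda>a. f a * y) has_sum x * y) A"
    by (intro has_sum_cmult_left assms)
qed

text \<open>The base \<open>1 - x\<close> is a positive real number, so the principal power of its inverse with
  exponent \<open>z\<close> is its own power with exponent \<open>-z\<close>. Absolute convergence follows by comparison
  with the real parameter \<open>\<bar>z\<bar>\<close>.\<close>
lemma has_sum_negative_binomial:
  fixes z :: complex and x :: real
  assumes "0 \<le> x" "x < 1"
  shows "((\<lambda>k. pochhammer z k / fact k * of_real x ^ k) has_sum
           complex_of_real (inverse (1 - x)) powr z) UNIV"
proof -
  have eq: "((- w) gchoose k) * (- of_real x) ^ k = pochhammer w k / fact k * of_real x ^ k"
    for w :: complex and k
    by (simp add: gbinomial_pochhammer power_mult_distrib[symmetric] flip: power_mult_distrib)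
  have sums: "(\<lambda>k. pochhammer w k / fact k * of_real x ^ k) sums (1 - of_real x) powr (- w)" for w :: complex
    using gen_binomial_complex[of "- of_real x" "- w"] assms unfolding eq by simp
  have real: "pochhammer (complex_of_real r) k / fact k * of_real x ^ k
      = of_real (pochhammer r k / fact k * x ^ k)" for r k
    by (simp add: pochhammer_of_real)
  have "summable (\<lambda>k. pochhammer (norm z) k / fact k * x ^ k)"
    using summable_Re[OF sums_summable[OF sums[of "of_real (norm z)"]]]
    unfolding real Re_complex_of_real .
  then have "summable (\<lambda>k. norm (pochhammer z k / fact k * of_real x ^ k))"
    by (rule summable_comparison_test'[where N = 0])
       (use assms in \<open>auto simp: norm_mult norm_divide norm_power
          intro!: mult_right_mono divide_right_mono norm_pochhammer_le\<close>)
  then have "((\<lambda>k. pochhammer z k / fact k * of_real x ^ k) has_sum (1 - of_real x) powr (- z)) UNIV"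
    by (rule norm_summable_imp_has_sum) (rule sums)
  moreover have "(1 - complex_of_real x) powr (- z) = complex_of_real (inverse (1 - x)) powr z"
  proof -
    have "complex_of_real (inverse (1 - x)) powr z = exp (z * Ln (of_real (inverse (1 - x))))"
      using assms by (simp add: powr_def)
    also have "Ln (of_real (inverse (1 - x))) = of_real (- ln (1 - x))"
      using assms by (subst Ln_of_real) (auto simp: ln_inverse)
    also have "\<dots> = - Ln (of_real (1 - x))"
      using assms by (subst Ln_of_real) auto
    finally show ?thesis using assms by (simp add: powr_def)
  qed
  ultimately show ?thesis by simp
qed

lemma smooth_zeta_pos:
  assumes "\<And>p. p \<in> S \<Longrightarrow> prime p" "s > 0"
  shows "smooth_zeta S s > 0"
  unfolding smooth_zeta_def
proof (intro prod_pos)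
  fix p assume "p \<in> S"
  then have "real p > 1" using assms prime_gt_1_nat by auto
  then show "inverse (1 - real p powr (- s)) > 0" using assms by (simp add: powr_less_one)
qed

text \<open>The Euler product of \<open>\<zeta>\<^sup>z\<close> over finitely many primes. A new prime multiplies the sum by a
  binomial series; the powers can be collected because all bases are positive.\<close>
lemma has_sum_gen_divisor_smooth:
  fixes z :: complex
  assumes "finite S" "\<And>p. p \<in> S \<Longrightarrow> prime p" "s > 0"
  shows "((\<lambda>n. gen_divisor z n * of_real (real n powr (- s))) has_sum
            complex_of_real (smooth_zeta S s) powr z) (smooth_numbers S)"
  using assms(1,2)
proof (induction S rule: finite_induct)
  case empty
  then show ?case
    by (simp add: smooth_numbers_empty smooth_zeta_def has_sum_finite_iff)
next
  case (insert p S)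
  have p: "prime p" "p > 1" "real p > 1" using insert prime_gt_1_nat by auto
  define x where "x = real p powr (- s)"
  have x: "0 \<le> x" "x < 1" using p assms by (auto simp: x_def powr_less_one)
  have "((\<lambda>(k, n). (pochhammer z k / fact k * of_real x ^ k) *
       (gen_divisor z n * of_real (real n powr (- s)))) has_sum
      complex_of_real (inverse (1 - x)) powr z * complex_of_real (smooth_zeta S s) powr z)
      (UNIV \<times> smooth_numbers S)"
    by (intro has_sum_mult_Times_complex has_sum_negative_binomial x insert) (use insert in auto)
  also have "complex_of_real (inverse (1 - x)) powr z * complex_of_real (smooth_zeta S s) powr z
      = complex_of_real (smooth_zeta (insert p S) s) powr z"
  proof -
    have "smooth_zeta S s > 0" using insert assms by (intro smooth_zeta_pos) auto
    moreover have "smooth_zeta (insert p S) s = inverse (1 - x) * smooth_zeta S s"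
      using insert by (simp add: smooth_zeta_def x_def)
    ultimately show ?thesis using x
      by (simp only: of_real_mult) (subst powr_times_real, auto simp del: of_real_inverse)
  qed
  also have "((\<lambda>(k, n). (pochhammer z k / fact k * of_real x ^ k) *
       (gen_divisor z n * of_real (real n powr (- s)))) has_sum
         complex_of_real (smooth_zeta (insert p S) s) powr z) (UNIV \<times> smooth_numbers S) \<longleftrightarrow>
      ((\<lambda>y. gen_divisor z (case y of (k, n) \<Rightarrow> p ^ k * n) *
         of_real (real (case y of (k, n) \<Rightarrow> p ^ k * n) powr (- s))) has_sum
         complex_of_real (smooth_zeta (insert p S) s) powr z) (UNIV \<times> smooth_numbers S)"
  proof (rule has_sum_cong)
    fix y :: "nat \<times> nat" assume "y \<in> UNIV \<times> smooth_numbers S"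
    then obtain k n where y: "y = (k, n)" "n \<in> smooth_numbers S" by auto
    then have n: "n > 0" "prime_factors n \<subseteq> S" by (auto simp: smooth_numbers_def)
    have pn: "\<not> p dvd n"
      using n p(1) insert.hyps(2) prime_factorsI[of n p] by auto
    have "real (p ^ k * n) powr (- s) = x ^ k * real n powr (- s)"
      using p by (simp add: x_def powr_mult powr_power powr_powr flip: powr_realpow) (simp add: mult_ac)
    then show "(case y of (k, n) \<Rightarrow> (pochhammer z k / fact k * of_real x ^ k) *
       (gen_divisor z n * of_real (real n powr (- s)))) =
       gen_divisor z (case y of (k, n) \<Rightarrow> p ^ k * n) *
         of_real (real (case y of (k, n) \<Rightarrow> p ^ k * n) powr (- s))"
      using gen_divisor_prime_power_mult[OF p(1) pn, of z k] by (simp add: y)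
  qed
  also have "\<dots> \<longleftrightarrow> ?case"
    by (rule has_sum_reindex_bij_betw[OF bij_betw_smooth_numbers_insert]) (use insert in auto)
  finally show ?case .
qed

lemma has_sum_gen_divisor_smooth_real:
  fixes x :: real
  assumes "finite S" "\<And>p. p \<in> S \<Longrightarrow> prime p" "s > 0"
  shows "((\<lambda>n. gen_divisor x n * real n powr (- s)) has_sum smooth_zeta S s powr x)
           (smooth_numbers S)"
proof -
  have "complex_of_real (smooth_zeta S s) powr of_real x = of_real (smooth_zeta S s powr x)"
    using smooth_zeta_pos[of S s] assms by (intro powr_of_real) auto
  then have "((\<lambda>n. complex_of_real (gen_divisor x n * real n powr (- s))) has_sum
      of_real (smooth_zeta S s powr x)) (smooth_numbers S)"
    using has_sum_gen_divisor_smooth[OF assms, of "of_real x"] by (simp add: of_real_gen_divisor)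
  then show ?thesis by (simp only: has_sum_of_real_iff)
qed

lemma has_sum_smooth_zeta:
  assumes "finite S" "\<And>p. p \<in> S \<Longrightarrow> prime p" "s > 0"
  shows "((\<lambda>n. real n powr (- s)) has_sum smooth_zeta S s) (smooth_numbers S)"
proof -
  have "((\<lambda>n. gen_divisor 1 n * real n powr (- s)) has_sum smooth_zeta S s powr 1)
           (smooth_numbers S)"
    by (intro has_sum_gen_divisor_smooth_real assms)
  also have "smooth_zeta S s powr 1 = smooth_zeta S s"
    using smooth_zeta_pos[of S s] assms by simp
  also have "((\<lambda>n. gen_divisor 1 n * real n powr (- s)) has_sum smooth_zeta S s) (smooth_numbers S)
      \<longleftrightarrow> ?thesis"
    by (intro has_sum_cong) (auto simp: smooth_numbers_def)
  finally show ?thesis .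
qed

section \<open>The factor at the primes dividing the level\<close>

lemma summable_zeta: "s > 1 \<Longrightarrow> summable (\<lambda>n. real (Suc n) powr (- s))"
  using summable_Suc_iff[of "\<lambda>n. real n powr (- s)"] by (simp add: summable_real_powr_iff)

lemma has_sum_zeta_real:
  assumes "s > 1"
  shows "((\<lambda>n. real n powr (- s)) has_sum zeta_real s) {1..}"
proof -
  have "((\<lambda>n. real (Suc n) powr (- s)) has_sum zeta_real s) UNIV"
    unfolding zeta_real_def
    by (intro sums_nonneg_imp_has_sum summable_sums summable_zeta assms) auto
  moreover have "bij_betw Suc UNIV {1..}"
    by (intro bij_betwI[where g = "\<lambda>n. n - 1"]) auto
  ultimately show ?thesis
    using has_sum_reindex_bij_betw[of Suc UNIV "{1..}" "\<lambda>n. real n powr (- s)" "zeta_real s"] by simp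
qed

lemma zeta_real_pos: "s > 1 \<Longrightarrow> zeta_real s > 0"
  unfolding zeta_real_def by (intro suminf_pos summable_zeta) auto

definition primes_upto :: "nat \<Rightarrow> nat set" where
  "primes_upto x = {p. prime p \<and> p \<le> x}"

lemma finite_primes_upto [simp]: "finite (primes_upto x)"
  by (auto simp: primes_upto_def)

lemma primes_uptoD [dest]: "p \<in> primes_upto x \<Longrightarrow> prime p"
  by (auto simp: primes_upto_def)

lemma atLeastAtMost_subset_smooth_numbers: "{1..x} \<subseteq> smooth_numbers (primes_upto x)"
proof
  fix n assume n: "n \<in> {1..x}"
  have "p \<le> x" if "p \<in> prime_factors n" for p
    using n that dvd_imp_le[of p n] by auto
  then show "n \<in> smooth_numbers (primes_upto x)"
    using n by (auto simp: smooth_numbers_def primes_upto_def)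
qed

lemma smooth_numbers_subset: "smooth_numbers S \<subseteq> {1..}"
  by (auto simp: smooth_numbers_def)

lemma smooth_zeta_le_zeta_real:
  assumes "finite S" "\<And>p. p \<in> S \<Longrightarrow> prime p" "s > 1"
  shows "smooth_zeta S s \<le> zeta_real s"
  using assms smooth_numbers_subset
  by (intro has_sum_mono2[OF has_sum_smooth_zeta has_sum_zeta_real]) auto

text \<open>All numbers up to \<open>x\<close> are smooth with respect to the primes up to \<open>x\<close>, so the finite Euler
  product lies between a partial sum of the zeta series and the full sum.\<close>
lemma euler_product_zeta_real:
  assumes "s > 1"
  shows "(\<lambda>x. smooth_zeta (primes_upto x) s) \<longlonglongrightarrow> zeta_real s"
proof (rule tendsto_sandwich)
  have "(\<Sum>n<x. real (Suc n) powr (- s)) = (\<Sum>n\<in>{1..x}. real n powr (- s))" for x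
    by (rule sum.reindex_bij_witness[of _ "\<lambda>n. n - 1" Suc]) auto
  moreover have "(\<Sum>n\<in>{1..x}. real n powr (- s)) \<le> smooth_zeta (primes_upto x) s" for x
    using assms atLeastAtMost_subset_smooth_numbers[of x]
    by (intro finite_sum_le_has_sum[OF has_sum_smooth_zeta]) auto
  ultimately show "\<forall>\<^sub>F x in sequentially. (\<Sum>n<x. real (Suc n) powr (- s)) \<le> smooth_zeta (primes_upto x) s"
    by simp
  show "\<forall>\<^sub>F x in sequentially. smooth_zeta (primes_upto x) s \<le> zeta_real s"
    using assms by (intro always_eventually allI smooth_zeta_le_zeta_real) auto
  show "(\<lambda>x. \<Sum>n<x. real (Suc n) powr (- s)) \<longlonglongrightarrow> zeta_real s"
    unfolding zeta_real_def using summable_zeta[OF assms] by (rule summable_LIMSEQ)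
qed simp

text \<open>A finite set of indices consists of smooth numbers for some finite set of primes. Hence the finite
  Euler products, and with them \<open>\<zeta>(s)\<^sup>y\<close>, bound all finite partial sums.\<close>
lemma summable_gen_divisor:
  fixes y :: real
  assumes "y \<ge> 0" "s > 1"
  shows "(\<lambda>n. gen_divisor y n * real n powr (- s)) summable_on {1..}"
proof (rule nonneg_bdd_above_summable_on)
  have "(\<Sum>n\<in>F. gen_divisor y n * real n powr (- s)) \<le> zeta_real s powr y"
    if F: "F \<subseteq> {1..}" "finite F" for F
  proof -
    obtain M where "\<And>n. n \<in> F \<Longrightarrow> n \<le> M"
        using F unfolding finite_nat_set_iff_bounded_le by blast
    then have "F \<subseteq> {1..M}" using F(1) by force
    then have "F \<subseteq> smooth_numbers (primes_upto M)"
      using atLeastAtMost_subset_smooth_numbers[of M] by blast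
    then have "(\<Sum>n\<in>F. gen_divisor y n * real n powr (- s)) \<le> smooth_zeta (primes_upto M) s powr y"
      using F assms
      by (intro finite_sum_le_has_sum[OF has_sum_gen_divisor_smooth_real])
         (auto simp: gen_divisor_nonneg)
    also have "\<dots> \<le> zeta_real s powr y"
      using assms
      by (intro powr_mono2 smooth_zeta_le_zeta_real less_imp_le[OF smooth_zeta_pos]) auto
    finally show ?thesis .
  qed
  then show "bdd_above (sum (\<lambda>n. gen_divisor y n * real n powr (- s)) ` {F. F \<subseteq> {1..} \<and> finite F})"
    by (intro bdd_aboveI2[where M = "zeta_real s powr y"]) auto
qed (use assms in \<open>auto simp: gen_divisor_nonneg\<close>)

text \<open>Passage from sums over smooth numbers to the sum over all numbers.\<close>
lemma has_sum_exhaustion: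
  fixes f :: "'a \<Rightarrow> 'b::real_normed_vector"
  assumes T: "(f has_sum T) A" and g: "\<And>x. (f has_sum g x) (B x)" and sub: "\<And>x. B x \<subseteq> A"
    and ev: "\<And>F. finite F \<Longrightarrow> F \<subseteq> A \<Longrightarrow> eventually (\<lambda>x. F \<subseteq> B x) G"
  shows "(g \<longlongrightarrow> T) G"
proof (rule tendstoI)
  fix e :: real assume e: "e > 0"
  have "eventually (\<lambda>F. dist (sum f F) T < e / 2) (finite_subsets_at_top A)"
    using T e unfolding has_sum_def tendsto_iff by (meson half_gt_zero)
  then obtain F0 where F0: "finite F0" "F0 \<subseteq> A"
    "\<And>F. finite F \<Longrightarrow> F0 \<subseteq> F \<Longrightarrow> F \<subseteq> A \<Longrightarrow> dist (sum f F) T < e / 2"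
    unfolding eventually_finite_subsets_at_top by metis
  show "eventually (\<lambda>x. dist (g x) T < e) G"
    using ev[OF F0(1,2)]
  proof eventually_elim
    case (elim x)
    have "eventually (\<lambda>F. dist (sum f F) (g x) < e / 2) (finite_subsets_at_top (B x))"
      using g[of x] e unfolding has_sum_def tendsto_iff by (meson half_gt_zero)
    then obtain F1 where F1: "finite F1" "F1 \<subseteq> B x"
      "\<And>F. finite F \<Longrightarrow> F1 \<subseteq> F \<Longrightarrow> F \<subseteq> B x \<Longrightarrow> dist (sum f F) (g x) < e / 2"
      unfolding eventually_finite_subsets_at_top by metis
    have "dist (sum f (F0 \<union> F1)) (g x) < e / 2"
      using F0(1,2) F1(1,2) elim by (intro F1(3)) auto
    moreover have "dist (sum f (F0 \<union> F1)) T < e / 2"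
      using F0(1,2) F1(1,2) sub[of x] by (intro F0(3)) auto
    ultimately show ?case using dist_triangle_half_r[of "sum f (F0 \<union> F1)" "g x" e T] by simp
  qed
qed

text \<open>The sum over the smooth numbers with primes up to \<open>x\<close> is the \<open>z\<close>-th power of a finite Euler
  product of \<open>\<zeta>\<close>. As \<open>x\<close> grows, it tends to the full sum and also to \<open>\<zeta>(s)\<^sup>z\<close>, because
  \<open>\<zeta>(s)\<close> is positive and the principal power is continuous there.\<close>
lemma has_sum_gen_divisor:
  assumes "s > 1"
  shows "((\<lambda>n. gen_divisor z n * of_real (real n powr (- s))) has_sum
            complex_of_real (zeta_real s) powr z) {1..}"
proof -
  let ?f = "\<lambda>n. gen_divisor z n * complex_of_real (real n powr (- s))"
  have "(\<lambda>n. norm (?f n)) summable_on {1..}"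
    by (rule Infinite_Sum.abs_summable_on_comparison_test'[OF summable_gen_divisor[of "norm z" s]])
       (use assms in \<open>auto simp: norm_mult intro!: mult_right_mono norm_gen_divisor_le\<close>)
  then have "?f summable_on {1..}" by (rule abs_summable_summable)
  then obtain T where T: "(?f has_sum T) {1..}" unfolding summable_on_def ..
  have "(\<lambda>x. complex_of_real (smooth_zeta (primes_upto x) s) powr z) \<longlonglongrightarrow> T"
  proof (rule has_sum_exhaustion[OF T])
    show "(?f has_sum complex_of_real (smooth_zeta (primes_upto x) s) powr z)
        (smooth_numbers (primes_upto x))" for x
      using assms by (intro has_sum_gen_divisor_smooth) auto
    show "\<forall>\<^sub>F x in sequentially. F \<subseteq> smooth_numbers (primes_upto x)"
      if F: "finite F" "F \<subseteq> {1..}" for F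
    proof -
      obtain M where M: "\<And>n. n \<in> F \<Longrightarrow> n \<le> M"
        using F unfolding finite_nat_set_iff_bounded_le by blast
      show ?thesis using eventually_ge_at_top[of M]
      proof eventually_elim
        case (elim x)
        have "n \<in> {1..x}" if "n \<in> F" for n
          using M[OF that] F(2) that elim by (auto dest: subsetD)
        then have "F \<subseteq> {1..x}" by blast
        then show ?case using atLeastAtMost_subset_smooth_numbers by blast
      qed
    qed
  qed (rule smooth_numbers_subset)
  moreover have "(\<lambda>x. complex_of_real (smooth_zeta (primes_upto x) s) powr z)
      \<longlonglongrightarrow> complex_of_real (zeta_real s) powr z"
    using zeta_real_pos[OF assms]
    by (intro tendsto_powr_complex tendsto_of_real euler_product_zeta_real assms tendsto_const)
       (auto simp: complex_nonpos_Reals_iff)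
  ultimately have "T = complex_of_real (zeta_real s) powr z" by (rule LIMSEQ_unique)
  with T show ?thesis by simp
qed

lemma tau_eq_gen_divisor: "tau z = gen_divisor z"
  unfolding tau_def
proof (rule dirichlet_coeffs_eqI)
  fix s :: real assume s: "s > 1"
  have "((\<lambda>n. gen_divisor z n * of_real (real n powr (- s))) has_sum
            complex_of_real (zeta_real s) powr z) UNIV"
    using has_sum_gen_divisor[OF s, of z]
    by (subst has_sum_cong_neutral[where T = "{1..}"
          and g = "\<lambda>n. gen_divisor z n * of_real (real n powr (- s))"]) (auto simp: not_le)
  then show "(\<lambda>n. gen_divisor z n * complex_of_real (real n powr - s)) sums
      complex_of_real (zeta_real s) powr z"
    by (rule has_sum_imp_sums)
qed (simp add: gen_divisor_def)

text \<open>The finite Euler product \<open>\<zeta>\<^sub>N(2s)\<close> is the sum of \<open>(k\<^sup>2)\<^sup>-\<^sup>s\<close> over the numbers \<open>k\<close> composed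
  of primes dividing \<open>N\<close>.\<close>
lemma square_ind_eq:
  "square_ind N n = (if \<exists>k\<in>smooth_numbers (prime_factors N). n = k ^ 2 then 1 else 0)"
proof -
  define S where "S = smooth_numbers (prime_factors N)"
  have S0: "0 \<notin> S" by (simp add: S_def smooth_numbers_def)
  let ?a = "\<lambda>n. if \<exists>k\<in>S. n = k ^ 2 then 1 else 0 :: complex"
  have "square_ind N = ?a"
    unfolding square_ind_def
  proof (rule dirichlet_coeffs_eqI)
    show "?a 0 = 0" using S0 by auto
    fix s :: real assume s: "s > 1"
    have "((\<lambda>k. real k powr (- (2 * s))) has_sum zeta_N N (2 * s)) S"
      unfolding S_def zeta_N_def smooth_zeta_def[symmetric] using s
      by (intro has_sum_smooth_zeta) auto
    then have "((\<lambda>k. complex_of_real (real k powr (- (2 * s)))) has_sum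
        complex_of_real (zeta_N N (2 * s))) S"
      by (rule has_sum_of_real)
    also have "?this \<longleftrightarrow> ((\<lambda>k. complex_of_real (real (k ^ 2) powr (- s))) has_sum
        complex_of_real (zeta_N N (2 * s))) S"
    proof (intro has_sum_cong)
      fix k assume "k \<in> S"
      then have k: "k > 0" using S0 by (cases k) auto
      have "real (k ^ 2) powr (- s) = (real k powr 2) powr (- s)" using k by simp
      also have "\<dots> = real k powr (- (2 * s))" by (simp only: powr_powr mult_minus_right)
      finally show "complex_of_real (real k powr (- (2 * s))) = complex_of_real (real (k ^ 2) powr (- s))"
        by simp
    qed
    also have "\<dots> \<longleftrightarrow> ((\<lambda>n. complex_of_real (real n powr (- s))) has_sum
        complex_of_real (zeta_N N (2 * s))) ((\<lambda>k. k ^ 2) ` S)"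
      by (subst has_sum_reindex) (auto simp: inj_on_def o_def)
    also have "\<dots> \<longleftrightarrow> ((\<lambda>n. ?a n * complex_of_real (real n powr (- s))) has_sum
        complex_of_real (zeta_N N (2 * s))) UNIV"
      by (rule has_sum_cong_neutral) auto
    finally show "(\<lambda>n. ?a n * complex_of_real (real n powr (- s))) sums
        complex_of_real (zeta_N N (2 * s))"
      by (rule has_sum_imp_sums)
  qed
  then show ?thesis by (simp add: S_def)
qed

lemma norm_infsum_le_has_sum:
  fixes f :: "'a \<Rightarrow> complex"
  assumes g: "(g has_sum c) A" and le: "\<And>x. x \<in> A \<Longrightarrow> norm (f x) \<le> g x"
  shows "f summable_on A" "norm (infsum f A) \<le> c"
proof -
  have n: "(\<lambda>x. norm (f x)) summable_on A"
    using g le by (intro Infinite_Sum.abs_summable_on_comparison_test'[where g = g]) (auto simp: has_sum_iff)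
  then show f: "f summable_on A" by (rule abs_summable_summable)
  have "norm (infsum f A) \<le> infsum (\<lambda>x. norm (f x)) A"
    using n f by (intro norm_has_sum_bound[of f A]) auto
  also have "\<dots> \<le> c"
    using n g le by (intro has_sum_mono[OF has_sum_infsum[OF n] g])
  finally show "norm (infsum f A) \<le> c" .
qed

lemma infsum_split_point:
  fixes f :: "'a \<Rightarrow> complex"
  assumes "f summable_on A" "a \<in> A"
  shows "infsum f A = f a + infsum f (A - {a})"
  using assms infsum_insert[of f "A - {a}" a] summable_on_subset_banach[of f A "A - {a}"]
  by (simp add: insert_absorb)

text \<open>The double sum over \<open>n\<close> and \<open>q\<close> is supported on numbers composed of primes in \<open>S\<close>, where
  it is dominated by the product of the Euler products for \<open>\<tau>\<^bsub>\<bar>z\<bar>\<^esub>(n) n\<^sup>-\<^sup>3\<^sup>/\<^sup>2\<close> and for \<open>1/q\<close>.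
  The pair \<open>n = q = 1\<close> contributes exactly 1 to the sum and to its majorant, hence the two
  subtractions of 1.\<close>
lemma norm_X_factor_minus_1_le:
  fixes N :: nat
  assumes "m \<ge> 1"
  defines "S \<equiv> prime_factors N"
  shows "norm (X_factor m z N - 1) \<le> smooth_zeta S (3/2) powr norm z * smooth_zeta S 1 - 1"
proof -
  define U where "U = smooth_numbers S"
  define A where "A = smooth_zeta S (3/2) powr norm z"
  define B where "B = smooth_zeta S 1"
  have S: "finite S" "\<And>p. p \<in> S \<Longrightarrow> prime p" by (auto simp: S_def)
  have U1: "1 \<in> U" "U \<subseteq> {1..}" by (auto simp: U_def smooth_numbers_def)
  have B: "((\<lambda>q. real q powr (- 1)) has_sum B) U"
    unfolding U_def B_def by (intro has_sum_smooth_zeta S) auto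
  have A: "((\<lambda>n. gen_divisor (norm z) n * real n powr (- (3/2))) has_sum A) U"
    unfolding U_def A_def by (intro has_sum_gen_divisor_smooth_real S) auto
  define inner where "inner = (\<lambda>n. \<Sum>\<^sub>\<infinity>q\<in>{1..}. square_ind N (n ^ m * q) / of_nat q)"
  have supp: "n \<in> U \<and> q \<in> U" if "square_ind N (n ^ m * q) \<noteq> 0" for n q
  proof -
    from that obtain k where k: "k \<in> U" "n ^ m * q = k ^ 2"
      by (auto simp: square_ind_eq U_def S_def split: if_splits)
    have k0: "k > 0" using k U1 by auto
    have "n dvd n ^ m" using assms by (intro dvd_power) auto
    then have "n dvd k ^ 2" "q dvd k ^ 2" using k(2) by (metis dvd_mult2, metis dvd_triv_right)
    moreover have "prime_factors (k ^ 2) \<subseteq> S"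
      using k by (auto simp: prime_factors_power U_def smooth_numbers_def)
    ultimately have "prime_factors n \<subseteq> S" "prime_factors q \<subseteq> S" "n > 0" "q > 0"
      using k0 dvd_prime_factors[of "k ^ 2" n] dvd_prime_factors[of "k ^ 2" q]
      by (auto intro!: gr0I)
    then show ?thesis by (auto simp: U_def smooth_numbers_def)
  qed
  have norm_sq: "norm (square_ind N k) \<le> 1" for k by (simp add: square_ind_eq)
  have term_le: "norm (square_ind N (n ^ m * q) / of_nat q) \<le> real q powr (- 1)" if "q \<in> U" for n q
    using that norm_sq[of "n ^ m * q"] U1
    by (auto simp: norm_divide powr_minus_divide intro!: divide_right_mono)
  have inner_U: "inner n = (\<Sum>\<^sub>\<infinity>q\<in>U. square_ind N (n ^ m * q) / of_nat q)" for n
    unfolding inner_def using supp U1 by (intro infsum_cong_neutral) auto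
  have inner_0: "inner n = 0" if "n \<notin> U" for n
    unfolding inner_def using supp that by (intro infsum_0) auto
  have inner_le: "norm (inner n) \<le> B" for n
    unfolding inner_U by (rule norm_infsum_le_has_sum[OF B term_le])
  have inner_1: "norm (inner 1 - 1) \<le> B - 1"
  proof -
    have "inner 1 = square_ind N (1 ^ m * 1) / of_nat 1 +
        (\<Sum>\<^sub>\<infinity>q\<in>U - {1}. square_ind N (1 ^ m * q) / of_nat q)"
      unfolding inner_U
      by (intro infsum_split_point norm_infsum_le_has_sum(1)[OF B term_le] U1)
    also have "square_ind N (1 ^ m * 1) / of_nat 1 = 1"
      using U1 by (auto simp: square_ind_eq U_def S_def intro!: bexI[of _ 1])
    finally have eq: "inner 1 - 1 = (\<Sum>\<^sub>\<infinity>q\<in>U - {1}. square_ind N (1 ^ m * q) / of_nat q)" by simp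
    have "((\<lambda>q. real q powr (- 1)) has_sum (B - (1::real))) (U - {1})"
      using U1 by (intro has_sum_Diff[OF B]) (auto simp: has_sum_finite_iff)
    then show ?thesis unfolding eq
      by (rule norm_infsum_le_has_sum) (use term_le[where n = 1] in auto)
  qed
  define c where "c = (\<lambda>n. tau z n / complex_of_real (real n powr (real m / 2 + 1)) * inner n)"
  have "X_factor m z N = infsum c {1..}"
    unfolding X_factor_def c_def inner_def ..
  also have "\<dots> = infsum c U"
    using inner_0 U1 by (intro infsum_cong_neutral) (auto simp: c_def)
  finally have X: "X_factor m z N = infsum c U" .
  have c_le: "norm (c n) \<le> gen_divisor (norm z) n * real n powr (- (3/2)) * B" if "n \<in> U" for n
  proof -
    have n: "real n \<ge> 1" using that U1 by auto
    have "norm (tau z n / complex_of_real (real n powr (real m / 2 + 1)))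
        = norm (gen_divisor z n) * real n powr (- (real m / 2 + 1))"
      by (simp add: tau_eq_gen_divisor norm_divide powr_minus_divide[of _ "real m / 2 + 1"]
          del: minus_add_distrib)
    also have "\<dots> \<le> gen_divisor (norm z) n * real n powr (- (3/2))"
      using n assms by (intro mult_mono norm_gen_divisor_le powr_mono gen_divisor_nonneg) auto
    finally show ?thesis
      unfolding c_def norm_mult
      by (intro mult_mono inner_le) (auto intro!: mult_nonneg_nonneg gen_divisor_nonneg)
  qed
  have AB: "((\<lambda>n. gen_divisor (norm z) n * real n powr (- (3/2)) * B) has_sum (A * B)) U"
    by (intro has_sum_cmult_left A)
  have "X_factor m z N = c 1 + infsum c (U - {1})"
    unfolding X by (intro infsum_split_point norm_infsum_le_has_sum(1)[OF AB c_le] U1)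
  also have "c 1 = inner 1" by (simp add: c_def tau_eq_gen_divisor)
  finally have "norm (X_factor m z N - 1) \<le> norm (inner 1 - 1) + norm (infsum c (U - {1}))"
    using norm_triangle_ineq[of "inner 1 - 1" "infsum c (U - {1})"] by (simp add: algebra_simps)
  also have "norm (infsum c (U - {1})) \<le> A * B - B"
  proof (rule norm_infsum_le_has_sum)
    show "((\<lambda>n. gen_divisor (norm z) n * real n powr (- (3/2)) * B) has_sum (A * B - B)) (U - {1})"
      using U1 by (intro has_sum_Diff[OF AB]) (auto simp: has_sum_finite_iff)
  qed (use c_le in auto)
  finally show ?thesis using inner_1 unfolding A_def B_def by simp
qed

lemma inverse_one_minus_le_exp:
  assumes "0 \<le> x" "x \<le> 1 / 2"
  shows "inverse (1 - x) \<le> exp (2 * x :: real)"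
proof -
  have "- x - 2 * x\<^sup>2 \<le> ln (1 - x)" using assms by (intro ln_one_minus_pos_lower_bound)
  moreover have "x\<^sup>2 \<le> x / 2" using assms mult_left_mono[of x "1/2" x] by (simp add: power2_eq_square)
  ultimately have "exp (- (2 * x)) \<le> exp (ln (1 - x))" by simp
  also have "\<dots> = 1 - x" using assms by simp
  finally show ?thesis using assms by (simp add: exp_minus field_simps)
qed

lemma smooth_zeta_le_exp:
  assumes "\<And>p. p \<in> S \<Longrightarrow> prime p" "s \<ge> 1"
  shows "smooth_zeta S s \<le> exp (2 * (\<Sum>p\<in>S. real p powr (- s)))"
proof -
  have "inverse (1 - real p powr (- s)) \<le> exp (2 * real p powr (- s))
      \<and> 0 \<le> inverse (1 - real p powr (- s))" if "p \<in> S" for p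
  proof -
    have p: "real p \<ge> 2" using assms that prime_ge_2_nat by force
    then have "real p powr (- s) \<le> real p powr (- 1)" using assms by (intro powr_mono) auto
    also have "\<dots> \<le> 1 / 2" using p by (simp add: powr_minus_divide divide_simps)
    finally show ?thesis by (auto intro!: inverse_one_minus_le_exp)
  qed
  then have "smooth_zeta S s \<le> (\<Prod>p\<in>S. exp (2 * real p powr (- s)))"
    unfolding smooth_zeta_def by (intro prod_mono) auto
  also have "\<dots> = exp (2 * (\<Sum>p\<in>S. real p powr (- s)))"
    by (cases "finite S") (simp_all add: exp_sum sum_distrib_left)
  finally show ?thesis .
qed

lemma norm_X_factor_minus_1_le_exp:
  assumes "m \<ge> 1"
  shows "norm (X_factor m z N - 1) \<le>
    exp (2 * (\<Sum>p\<in>prime_factors N. norm z * real p powr (- (3/2)) + real p powr (- 1))) - 1"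
proof -
  let ?S = "prime_factors N"
  have pos: "smooth_zeta ?S s > 0" if "s > 0" for s
    using that by (intro smooth_zeta_pos) auto
  have "smooth_zeta ?S (3/2) powr norm z \<le> exp (2 * (\<Sum>p\<in>?S. real p powr (- (3/2)))) powr norm z"
    using pos[of "3/2"] by (intro powr_mono2 smooth_zeta_le_exp) auto
  also have "\<dots> = exp (2 * (\<Sum>p\<in>?S. norm z * real p powr (- (3/2))))"
    by (simp add: powr_def sum_distrib_left mult_ac)
  finally have "smooth_zeta ?S (3/2) powr norm z * smooth_zeta ?S 1
      \<le> exp (2 * (\<Sum>p\<in>?S. norm z * real p powr (- (3/2)))) * exp (2 * (\<Sum>p\<in>?S. real p powr (- 1)))"
    using pos[of 1] by (intro mult_mono smooth_zeta_le_exp) auto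
  then show ?thesis
    using norm_X_factor_minus_1_le[OF assms, of z N]
    by (simp add: sum.distrib distrib_left exp_add)
qed

section \<open>Haar integrals on SU(2)\<close>

text \<open>For a unitary matrix of determinant 1 the adjugate, which is the inverse, is the conjugate
  transpose. The first column therefore determines the matrix and is a unit vector.\<close>
lemma SU2_entries:
  assumes "g \<in> SU2"
  shows "g $ 2 $ 2 = cnj (g $ 1 $ 1)" "g $ 1 $ 2 = - cnj (g $ 2 $ 1)"
    "g $ 1 $ 1 * g $ 2 $ 2 - g $ 1 $ 2 * g $ 2 $ 1 = 1"
    "cnj (g $ 1 $ 1) * g $ 1 $ 1 + cnj (g $ 2 $ 1) * g $ 2 $ 1 = 1"
proof -
  define a b c d where "a = g $ 1 $ 1" "b = g $ 1 $ 2" "c = g $ 2 $ 1" "d = g $ 2 $ 2"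
  note defs = this
  have e: "cnj a * a + cnj c * c = 1" "cnj a * b + cnj c * d = 0"
    using assms
    by (auto simp: SU2_def Finite_Cartesian_Product.vec_eq_iff matrix_matrix_mult_def sum_2 forall_2 defs
        Finite_Cartesian_Product.mat_def)
  have det: "a * d - b * c = 1"
    using assms by (simp add: SU2_def det_2 defs)
  have "d = (cnj a * a + cnj c * c) * d" using e by simp
  also have "\<dots> = cnj a * (a * d - b * c) + c * (cnj a * b + cnj c * d)" by (simp add: algebra_simps)
  also have "\<dots> = cnj a" using e det by simp
  finally have d: "d = cnj a" .
  have "b = (cnj a * a + cnj c * c) * b" using e by simp
  also have "\<dots> = a * (cnj a * b + cnj c * d) - cnj c * (a * d - b * c)" by (simp add: algebra_simps)
  also have "\<dots> = - cnj c" using e det by simp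
  finally have b: "b = - cnj c" .
  from b d det e show "g $ 2 $ 2 = cnj (g $ 1 $ 1)" "g $ 1 $ 2 = - cnj (g $ 2 $ 1)"
    "g $ 1 $ 1 * g $ 2 $ 2 - g $ 1 $ 2 * g $ 2 $ 1 = 1"
    "cnj (g $ 1 $ 1) * g $ 1 $ 1 + cnj (g $ 2 $ 1) * g $ 2 $ 1 = 1"
    by (simp_all add: defs)
qed

text \<open>The matrix of left multiplication by the quaternion \<open>u + j v\<close>, in the coordinates \<open>(a, b)\<close> of the
  quaternion \<open>a + j b\<close>.\<close>
definition quat :: "complex \<Rightarrow> complex \<Rightarrow> complex^2^2" where
  "quat u v = vector [vector [u, - cnj v], vector [v, cnj u]]"

lemma quat_in_SU2:
  assumes "cnj u * u + cnj v * v = 1"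
  shows "quat u v \<in> SU2"
  using assms
  by (auto simp: SU2_def Finite_Cartesian_Product.vec_eq_iff matrix_matrix_mult_def sum_2 forall_2 quat_def vector_2 det_2
        Finite_Cartesian_Product.mat_def mult_ac add_ac)

lemma quat_mult_entry: "(quat u v ** g) $ 1 $ 1 = u * g $ 1 $ 1 - cnj v * g $ 2 $ 1"
  by (simp add: matrix_matrix_mult_def sum_2 quat_def vector_2)

lemma SU2_mult:
  assumes "h \<in> SU2" "g \<in> SU2"
  shows "h ** g \<in> SU2"
proof -
  define adj :: "complex^2^2 \<Rightarrow> complex^2^2" where "adj = (\<lambda>g. \<chi> i j. cnj (g $ j $ i))"
  have "adj (h ** g) = adj g ** adj h"
    by (simp add: adj_def Finite_Cartesian_Product.vec_eq_iff matrix_matrix_mult_def mult.commute)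
  then have "adj (h ** g) ** (h ** g) = adj g ** (adj h ** h) ** g"
    by (simp add: matrix_mul_assoc)
  then show ?thesis using assms
    by (auto simp: SU2_def adj_def Determinants.det_mul)
qed

lemma SU2_norm_entry_le:
  assumes "g \<in> SU2"
  shows "norm (g $ i $ j) \<le> 1"
proof -
  note E = SU2_entries[OF assms]
  have *: "(norm (g $ 1 $ 1))\<^sup>2 + (norm (g $ 2 $ 1))\<^sup>2 = 1"
    using E(4) by (simp add: complex_eq_iff cmod_power2) (simp add: power2_eq_square)
  have "(norm (g $ 1 $ 1))\<^sup>2 \<le> 1\<^sup>2" "(norm (g $ 2 $ 1))\<^sup>2 \<le> 1\<^sup>2"
    using * zero_le_power2[of "norm (g $ 1 $ 1)"] zero_le_power2[of "norm (g $ 2 $ 1)"]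
    unfolding one_power2 by linarith+
  then have "norm (g $ 1 $ 1) \<le> 1" "norm (g $ 2 $ 1) \<le> 1"
    by (blast intro: power2_le_imp_le zero_le_one)+
  then show ?thesis
    using E(1,2) exhaust_2[of i] exhaust_2[of j] by auto
qed

text \<open>Compactness makes every continuous function on the group integrable for a finite measure.\<close>
lemma compact_SU2: "compact SU2"
proof -
  have "closed SU2"
    unfolding SU2_def matrix_matrix_mult_def det_2 Collect_conj_eq
    by (intro closed_Int closed_Collect_eq continuous_intros)
  moreover have "norm g \<le> 4" if "g \<in> SU2" for g
  proof -
    have row: "norm (g $ i) \<le> 2" for i
      using L2_set_le_sum[of UNIV "\<lambda>j. norm (g $ i $ j)"]
        SU2_norm_entry_le[OF that, of i 1] SU2_norm_entry_le[OF that, of i 2]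
      by (simp add: norm_vec_def sum_2)
    show ?thesis
      using L2_set_le_sum[of UNIV "\<lambda>i. norm (g $ i)"] row[of 1] row[of 2]
      by (simp add: norm_vec_def[of g] sum_2)
  qed
  then have "bounded SU2" by (auto simp: bounded_iff)
  ultimately show ?thesis by (simp add: compact_eq_bounded_closed)
qed

context
  fixes \<mu> :: "(complex^2^2) measure"
  assumes haar: "haar_SU2 \<mu>"
begin

interpretation prob_space \<mu> using haar by (simp add: haar_SU2_def)

lemma haar_measurable:
  fixes f :: "complex^2^2 \<Rightarrow> 'b::topological_space"
  assumes "continuous_on SU2 f"
  shows "f \<in> borel_measurable \<mu>"
proof -
  have "sets \<mu> = sets (restrict_space borel SU2)" using haar by (simp add: haar_SU2_def)
  then show ?thesis
    using borel_measurable_continuous_on_restrict[OF assms] measurable_cong_sets by blast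
qed

lemma haar_integrable:
  fixes f :: "complex^2^2 \<Rightarrow> 'b::{banach, second_countable_topology}"
  assumes "continuous_on SU2 f"
  shows "integrable \<mu> f"
proof -
  have "bounded (f ` SU2)"
    using compact_continuous_image[OF assms compact_SU2] compact_imp_bounded by blast
  then obtain B where "\<And>g. g \<in> SU2 \<Longrightarrow> norm (f g) \<le> B" by (auto simp: bounded_iff)
  moreover have "space \<mu> = SU2" using haar by (simp add: haar_SU2_def)
  ultimately show ?thesis
    by (intro integrable_const_bound[of _ B] haar_measurable assms) auto
qed

lemma haar_integral_translate:
  fixes f :: "complex^2^2 \<Rightarrow> 'b::{banach, second_countable_topology}"
  assumes "h \<in> SU2" "continuous_on SU2 f"
  shows "(LINT g|\<mu>. f (h ** g)) = (LINT g|\<mu>. f g)"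
proof -
  have sets: "sets \<mu> = sets (restrict_space borel SU2)" and inv: "distr \<mu> \<mu> (\<lambda>g. h ** g) = \<mu>"
    using haar assms by (auto simp: haar_SU2_def)
  have "continuous_on SU2 (\<lambda>g. h ** g)"
    unfolding matrix_matrix_mult_def by (intro continuous_intros)
  then have "(\<lambda>g. h ** g) \<in> restrict_space borel SU2 \<rightarrow>\<^sub>M restrict_space borel SU2"
    using SU2_mult[OF assms(1)]
    by (intro measurable_restrict_space2 borel_measurable_continuous_on_restrict)
       (auto simp: space_restrict_space)
  then have "(\<lambda>g. h ** g) \<in> \<mu> \<rightarrow>\<^sub>M \<mu>"
    using measurable_cong_sets[OF sets sets] by blast
  from integral_distr[OF this haar_measurable[OF assms(2)]] inv show ?thesis by simp
qed

text \<open>The group is the unit sphere of the quaternions, \<open>Re (g $ 1 $ 1)\<close> is the real part, and the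
  three functions admitted for \<open>y\<close> are the other coordinates. Left multiplication by a suitable
  unit quaternion \<open>c + s e\<close>, with \<open>e\<close> one of the imaginary units, sends the real part \<open>x\<close> to
  \<open>c x - s y\<close>.\<close>
lemma haar_integral_rotate:
  fixes \<phi> :: "real \<Rightarrow> real"
  assumes \<phi>: "continuous_on UNIV \<phi>" and cs: "c\<^sup>2 + s\<^sup>2 = 1"
    and y: "y \<in> {\<lambda>g. Im (g $ 1 $ 1), \<lambda>g. Re (g $ 2 $ 1), \<lambda>g. Im (g $ 2 $ 1)}"
  shows "(LINT g|\<mu>. \<phi> (c * Re (g $ 1 $ 1) - s * y g)) = (LINT g|\<mu>. \<phi> (Re (g $ 1 $ 1)))"
proof -
  have "\<exists>u v. cnj u * u + cnj v * v = 1 \<and>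
      (\<forall>g::complex^2^2. Re (u * g $ 1 $ 1 - cnj v * g $ 2 $ 1) = c * Re (g $ 1 $ 1) - s * y g)"
    using y
  proof (elim insertE emptyE)
    assume "y = (\<lambda>g. Im (g $ 1 $ 1))"
    then show ?thesis using cs
      by (intro exI[of _ "Complex c s"] exI[of _ 0]) (auto simp: complex_eq_iff power2_eq_square)
  next
    assume "y = (\<lambda>g. Re (g $ 2 $ 1))"
    then show ?thesis using cs
      by (intro exI[of _ "Complex c 0"] exI[of _ "Complex s 0"]) (auto simp: complex_eq_iff power2_eq_square)
  next
    assume "y = (\<lambda>g. Im (g $ 2 $ 1))"
    then show ?thesis using cs
      by (intro exI[of _ "Complex c 0"] exI[of _ "Complex 0 s"]) (auto simp: complex_eq_iff power2_eq_square)
  qed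
  then obtain u v where uv: "cnj u * u + cnj v * v = 1"
    "\<And>g::complex^2^2. Re (u * g $ 1 $ 1 - cnj v * g $ 2 $ 1) = c * Re (g $ 1 $ 1) - s * y g"
    by blast
  have "(LINT g|\<mu>. \<phi> (Re ((quat u v ** g) $ 1 $ 1))) = (LINT g|\<mu>. \<phi> (Re (g $ 1 $ 1)))"
    by (intro haar_integral_translate quat_in_SU2 uv continuous_on_compose2[OF \<phi>] continuous_intros) auto
  then show ?thesis by (simp only: quat_mult_entry uv(2))
qed

text \<open>A quarter turn exchanges \<open>x\<close> and \<open>y\<close> up to sign. For the mixed moment, the mean of \<open>x\<^sup>4\<close> is
  also the mean of \<open>(x - y)\<^sup>4 / 4\<close> and of \<open>(x + y)\<^sup>4 / 4\<close>, by the rotations through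
  \<open>\<plusminus>\<pi>/4\<close>; adding the two removes the odd terms.\<close>
lemma haar_integral_coord:
  assumes y: "y \<in> {\<lambda>g. Im (g $ 1 $ 1), \<lambda>g. Re (g $ 2 $ 1), \<lambda>g. Im (g $ 2 $ 1)}"
  shows "(LINT g|\<mu>. (y g)\<^sup>2) = (LINT g|\<mu>. (Re (g $ 1 $ 1))\<^sup>2)" (is ?A)
    and "(LINT g|\<mu>. (Re (g $ 1 $ 1))\<^sup>2 * (y g)\<^sup>2) = (LINT g|\<mu>. (Re (g $ 1 $ 1)) ^ 4) / 3" (is ?B)
proof -
  have "continuous_on UNIV (\<lambda>x::real. x\<^sup>2)" by (intro continuous_intros)
  from haar_integral_rotate[OF this _ y, of 0 1] show ?A by simp
  let ?x = "\<lambda>g::complex^2^2. Re (g $ 1 $ 1)"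
  have y_cont: "continuous_on SU2 y" using y by (auto intro!: continuous_intros)
  have int: "integrable \<mu> (\<lambda>g. ?x g ^ 4)" "integrable \<mu> (\<lambda>g. y g ^ 4)"
      "integrable \<mu> (\<lambda>g. (?x g)\<^sup>2 * (y g)\<^sup>2)"
    by (intro haar_integrable continuous_intros y_cont)+
  have cont4: "continuous_on UNIV (\<lambda>x::real. x ^ 4)" by (intro continuous_intros)
  have fourth: "(LINT g|\<mu>. (y g) ^ 4) = (LINT g|\<mu>. ?x g ^ 4)"
    using haar_integral_rotate[OF cont4 _ y, of 0 1] by simp
  have quartic: "(1 / sqrt 2 * a - 1 / sqrt 2 * b) ^ 4 + (1 / sqrt 2 * a - (- 1 / sqrt 2) * b) ^ 4
      = (a ^ 4 + b ^ 4) / 2 + 3 * (a\<^sup>2 * b\<^sup>2)" for a b :: real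
  proof -
    have "(1 / sqrt 2) ^ 4 = (1 / 4 :: real)"
      using power_mult[of "1 / sqrt 2" 2 2] by (simp add: power_divide)
    moreover have "(1 / sqrt 2 * a - 1 / sqrt 2 * b) ^ 4 + (1 / sqrt 2 * a - (- 1 / sqrt 2) * b) ^ 4
        = (1 / sqrt 2 * (a - b)) ^ 4 + (1 / sqrt 2 * (a + b)) ^ 4"
      by (simp add: diff_divide_distrib add_divide_distrib)
    ultimately show ?thesis unfolding power_mult_distrib by (simp add: power2_eq_square power4_eq_xxxx algebra_simps)
  qed
  have "2 * (LINT g|\<mu>. ?x g ^ 4) =
      (LINT g|\<mu>. (1 / sqrt 2 * ?x g - 1 / sqrt 2 * y g) ^ 4) +
      (LINT g|\<mu>. (1 / sqrt 2 * ?x g - (- 1 / sqrt 2) * y g) ^ 4)"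
    using haar_integral_rotate[OF cont4 _ y, of "1 / sqrt 2" "1 / sqrt 2"]
      haar_integral_rotate[OF cont4 _ y, of "1 / sqrt 2" "- 1 / sqrt 2"]
    by (simp add: power_divide)
  also have "\<dots> = (LINT g|\<mu>. (1 / sqrt 2 * ?x g - 1 / sqrt 2 * y g) ^ 4 +
      (1 / sqrt 2 * ?x g - (- 1 / sqrt 2) * y g) ^ 4)"
    by (intro Bochner_Integration.integral_add[symmetric] haar_integrable continuous_intros y_cont)
  also have "\<dots> = (LINT g|\<mu>. (?x g ^ 4 + y g ^ 4) / 2 + 3 * ((?x g)\<^sup>2 * (y g)\<^sup>2))"
    unfolding quartic ..
  also have "(LINT g|\<mu>. (?x g ^ 4 + y g ^ 4) / 2 + 3 * ((?x g)\<^sup>2 * (y g)\<^sup>2)) =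
      ((LINT g|\<mu>. ?x g ^ 4) + (LINT g|\<mu>. y g ^ 4)) / 2 + 3 * (LINT g|\<mu>. (?x g)\<^sup>2 * (y g)\<^sup>2)"
    by (simp add: int)
  finally show ?B using fourth by simp
qed

text \<open>The squares of the four coordinates have the same mean and add up to 1, whence 1/4. Multiplying
  the equation of the sphere by the square of the first coordinate gives \<open>1/4 = A + 3 (A/3)\<close>
  for the fourth moment \<open>A\<close>.\<close>
lemma haar_moments:
  shows "(LINT g|\<mu>. Re (g $ 1 $ 1)) = 0"
    and "(LINT g|\<mu>. (Re (g $ 1 $ 1))\<^sup>2) = 1 / 4"
    and "(LINT g|\<mu>. (Re (g $ 1 $ 1)) ^ 4) = 1 / 8"
proof -
  define x0 x1 x2 x3 :: "complex^2^2 \<Rightarrow> real" where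
    "x0 = (\<lambda>g. Re (g $ 1 $ 1))" and "x1 = (\<lambda>g. Im (g $ 1 $ 1))"
    and "x2 = (\<lambda>g. Re (g $ 2 $ 1))" and "x3 = (\<lambda>g. Im (g $ 2 $ 1))"
  note x_def = this
  have cont [continuous_intros]: "continuous_on SU2 x0" "continuous_on SU2 x1"
    "continuous_on SU2 x2" "continuous_on SU2 x3"
    by (auto simp: x_def intro!: continuous_intros)
  have int: "integrable \<mu> (\<lambda>g. (x0 g)\<^sup>2)" "integrable \<mu> (\<lambda>g. (x1 g)\<^sup>2)"
      "integrable \<mu> (\<lambda>g. (x2 g)\<^sup>2)" "integrable \<mu> (\<lambda>g. (x3 g)\<^sup>2)"
      "integrable \<mu> (\<lambda>g. x0 g ^ 4)" "integrable \<mu> (\<lambda>g. (x0 g)\<^sup>2 * (x1 g)\<^sup>2)"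
      "integrable \<mu> (\<lambda>g. (x0 g)\<^sup>2 * (x2 g)\<^sup>2)" "integrable \<mu> (\<lambda>g. (x0 g)\<^sup>2 * (x3 g)\<^sup>2)"
    by (intro haar_integrable continuous_intros)+
  have "(LINT g|\<mu>. - x0 g) = (LINT g|\<mu>. x0 g)"
    using haar_integral_rotate[of "\<lambda>x. x" "-1" 0 x1] by (simp add: x_def)
  then show "(LINT g|\<mu>. Re (g $ 1 $ 1)) = 0" by (simp add: x_def)
  have sphere: "(x0 g)\<^sup>2 + (x1 g)\<^sup>2 + (x2 g)\<^sup>2 + (x3 g)\<^sup>2 = 1" if "g \<in> SU2" for g
    using SU2_entries(4)[OF that] by (simp add: complex_eq_iff x_def power2_eq_square)
  have sp: "space \<mu> = SU2" using haar by (simp add: haar_SU2_def)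
  have "1 = (LINT g|\<mu>. 1 :: real)" using prob_space by simp
  also have "\<dots> = (LINT g|\<mu>. (x0 g)\<^sup>2 + (x1 g)\<^sup>2 + (x2 g)\<^sup>2 + (x3 g)\<^sup>2)"
    by (intro Bochner_Integration.integral_cong) (auto simp: sphere sp)
  also have "\<dots> = (LINT g|\<mu>. (x0 g)\<^sup>2) + (LINT g|\<mu>. (x1 g)\<^sup>2) + (LINT g|\<mu>. (x2 g)\<^sup>2) + (LINT g|\<mu>. (x3 g)\<^sup>2)"
    by (simp add: int)
  also have "\<dots> = 4 * (LINT g|\<mu>. (x0 g)\<^sup>2)"
    using haar_integral_coord(1)[of x1] haar_integral_coord(1)[of x2] haar_integral_coord(1)[of x3]
    by (simp add: x_def)
  finally have second: "(LINT g|\<mu>. (x0 g)\<^sup>2) = 1 / 4" by simp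
  then show "(LINT g|\<mu>. (Re (g $ 1 $ 1))\<^sup>2) = 1 / 4" by (simp add: x_def)
  have "(LINT g|\<mu>. (x0 g)\<^sup>2) = (LINT g|\<mu>. x0 g ^ 4 + (x0 g)\<^sup>2 * (x1 g)\<^sup>2
      + (x0 g)\<^sup>2 * (x2 g)\<^sup>2 + (x0 g)\<^sup>2 * (x3 g)\<^sup>2)"
  proof (intro Bochner_Integration.integral_cong refl)
    fix g assume "g \<in> space \<mu>"
    then have "(x0 g)\<^sup>2 = (x0 g)\<^sup>2 * ((x0 g)\<^sup>2 + (x1 g)\<^sup>2 + (x2 g)\<^sup>2 + (x3 g)\<^sup>2)"
      by (simp add: sphere sp)
    then show "(x0 g)\<^sup>2 = x0 g ^ 4 + (x0 g)\<^sup>2 * (x1 g)\<^sup>2 + (x0 g)\<^sup>2 * (x2 g)\<^sup>2 + (x0 g)\<^sup>2 * (x3 g)\<^sup>2"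
      by (simp add: distrib_left flip: power_add)
  qed
  also have "\<dots> = (LINT g|\<mu>. x0 g ^ 4) + (LINT g|\<mu>. (x0 g)\<^sup>2 * (x1 g)\<^sup>2)
      + (LINT g|\<mu>. (x0 g)\<^sup>2 * (x2 g)\<^sup>2) + (LINT g|\<mu>. (x0 g)\<^sup>2 * (x3 g)\<^sup>2)"
    by (simp add: int)
  also have "\<dots> = 2 * (LINT g|\<mu>. x0 g ^ 4)"
    using haar_integral_coord(2)[of x1] haar_integral_coord(2)[of x2] haar_integral_coord(2)[of x3]
    by (simp add: x_def)
  finally show "(LINT g|\<mu>. (Re (g $ 1 $ 1)) ^ 4) = 1 / 8" using second by (simp add: x_def)
qed

end

section \<open>Determinants of symmetric powers to first order\<close>

lemma prod_one_minus_approx: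
  fixes B :: real
  assumes "B \<ge> 0"
  shows "\<exists>C\<ge>0. \<forall>(u :: nat \<Rightarrow> complex) Y. 0 \<le> Y \<and> Y \<le> 1 \<and> (\<forall>i<n. norm (u i) \<le> B * Y) \<longrightarrow>
           norm ((\<Prod>i<n. 1 - u i) - (1 - (\<Sum>i<n. u i))) \<le> C * Y\<^sup>2"
proof (induction n)
  case 0
  show ?case by (intro exI[of _ 0]) auto
next
  case (Suc n)
  then obtain C where C: "C \<ge> 0" "\<And>(u :: nat \<Rightarrow> complex) Y. 0 \<le> Y \<Longrightarrow> Y \<le> 1 \<Longrightarrow>
      (\<And>i. i < n \<Longrightarrow> norm (u i) \<le> B * Y) \<Longrightarrow>
      norm ((\<Prod>i<n. 1 - u i) - (1 - (\<Sum>i<n. u i))) \<le> C * Y\<^sup>2"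
    by blast
  show ?case
  proof (intro exI[of _ "C * (1 + B) + B * (real n * B)"] conjI allI impI)
    show "0 \<le> C * (1 + B) + B * (real n * B)" using C assms by simp
    fix u :: "nat \<Rightarrow> complex" and Y :: real
    assume "0 \<le> Y \<and> Y \<le> 1 \<and> (\<forall>i<Suc n. norm (u i) \<le> B * Y)"
    then have Y: "0 \<le> Y" "Y \<le> 1" and u: "\<And>i. i \<le> n \<Longrightarrow> norm (u i) \<le> B * Y" by auto
    define P S where "P = (\<Prod>i<n. 1 - u i)" and "S = (\<Sum>i<n. u i)"
    have "norm (P - (1 - S)) \<le> C * Y\<^sup>2"
      unfolding P_def S_def using Y u by (intro C(2)) auto
    moreover have "norm (1 - u n) \<le> 1 + B"
    proof -
      have "norm (1 - u n) \<le> norm (1::complex) + norm (u n)" by (rule norm_triangle_ineq4)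
      also have "norm (u n) \<le> B * Y" by (intro u) auto
      also have "B * Y \<le> B * 1" using assms Y by (intro mult_left_mono) auto
      finally show ?thesis by simp
    qed
    ultimately have 1: "norm ((P - (1 - S)) * (1 - u n)) \<le> C * Y\<^sup>2 * (1 + B)"
      unfolding norm_mult using C(1) by (intro mult_mono) auto
    have "norm S \<le> (\<Sum>i<n. B * Y)"
      unfolding S_def using u by (intro sum_norm_le) auto
    then have 2: "norm (u n * S) \<le> (B * Y) * (real n * (B * Y))"
      unfolding norm_mult using u[of n] assms Y by (intro mult_mono) auto
    have "(\<Prod>i<Suc n. 1 - u i) - (1 - (\<Sum>i<Suc n. u i)) = (P - (1 - S)) * (1 - u n) + u n * S"
      by (simp add: P_def S_def algebra_simps)
    also have "norm \<dots> \<le> C * Y\<^sup>2 * (1 + B) + (B * Y) * (real n * (B * Y))"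
      using 1 2 norm_triangle_ineq[of "(P - (1 - S)) * (1 - u n)" "u n * S"] by linarith
    also have "\<dots> = (C * (1 + B) + B * (real n * B)) * Y\<^sup>2"
      by (simp add: algebra_simps power2_eq_square)
    finally show "norm ((\<Prod>i<Suc n. 1 - u i) - (1 - (\<Sum>i<Suc n. u i)))
        \<le> (C * (1 + B) + B * (real n * B)) * Y\<^sup>2" .
  qed
qed

text \<open>In the Leibniz expansion the identity permutation gives the product of the diagonal entries,
  which is \<open>1 - Y tr M\<close> up to \<open>O(Y\<^sup>2)\<close>. Any other permutation moves at least two indices and so
  picks up two off-diagonal entries, each of size \<open>O(Y)\<close>.\<close>
lemma det_one_minus_smult_approx:
  fixes B :: real
  assumes "B \<ge> 0"
  obtains C where "C \<ge> 0"
    and "\<And>(M :: complex Matrix.mat) Y. M \<in> carrier_mat n n \<Longrightarrow> 0 \<le> Y \<Longrightarrow> Y \<le> 1 \<Longrightarrow>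
           (\<And>i j. i < n \<Longrightarrow> j < n \<Longrightarrow> norm (M $$ (i, j)) \<le> B) \<Longrightarrow>
           norm (Determinant.det (1\<^sub>m n - complex_of_real Y \<cdot>\<^sub>m M)
             - (1 - of_real Y * (\<Sum>i<n. M $$ (i, i)))) \<le> C * Y\<^sup>2"
proof -
  obtain C where C: "C \<ge> 0" "\<And>(u :: nat \<Rightarrow> complex) Y. 0 \<le> Y \<Longrightarrow> Y \<le> 1 \<Longrightarrow>
      (\<And>i. i < n \<Longrightarrow> norm (u i) \<le> B * Y) \<Longrightarrow>
      norm ((\<Prod>i<n. 1 - u i) - (1 - (\<Sum>i<n. u i))) \<le> C * Y\<^sup>2"
    using prod_one_minus_approx[OF assms, of n] by blast
  define D where "D = 1 + B"
  have D: "D \<ge> 1" using assms by (simp add: D_def)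
  show ?thesis
  proof (rule that[of "C + real (fact n) * D ^ n"])
    show "0 \<le> C + real (fact n) * D ^ n" using C D by simp
    fix M :: "complex Matrix.mat" and Y :: real
    assume M: "M \<in> carrier_mat n n" and Y: "0 \<le> Y" "Y \<le> 1"
      and MB: "\<And>i j. i < n \<Longrightarrow> j < n \<Longrightarrow> norm (M $$ (i, j)) \<le> B"
    define A where "A = 1\<^sub>m n - complex_of_real Y \<cdot>\<^sub>m M"
    have A: "A \<in> carrier_mat n n" unfolding A_def by (intro minus_carrier_mat smult_carrier_mat M)
    have entry: "A $$ (i, j) = (if i = j then 1 else 0) - of_real Y * M $$ (i, j)" if "i < n" "j < n" for i j
      using M that by (simp add: A_def)
    have YM: "norm (of_real Y * M $$ (i, j)) \<le> B * Y" if "i < n" "j < n" for i j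
      using mult_right_mono[OF MB[OF that] Y(1)] Y(1) by (simp add: norm_mult mult.commute)
    have BY: "B * Y \<le> B" using mult_left_mono[OF Y(2) assms] by simp
    have diag_le: "norm (A $$ (i, j)) \<le> D" if "i < n" "j < n" for i j
      using norm_triangle_ineq4[of "if i = j then 1 else 0" "of_real Y * M $$ (i, j)"]
        YM[OF that] BY unfolding entry[OF that] D_def by (auto split: if_splits)
    have off_le: "norm (A $$ (i, j)) \<le> D * Y" if "i < n" "j < n" "i \<noteq> j" for i j
      using YM[OF that(1,2)] that(3) Y unfolding entry[OF that(1,2)] D_def
      by (simp add: distrib_right)
    define T where "T = (\<lambda>\<pi>. signof \<pi> * (\<Prod>i = 0..<n. A $$ (i, \<pi> i)))"
    have "T id = (\<Prod>i<n. 1 - of_real Y * M $$ (i, i))"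
      by (auto simp: T_def entry atLeast0LessThan intro!: prod.cong)
    then have T_id: "norm (T id - (1 - of_real Y * (\<Sum>i<n. M $$ (i, i)))) \<le> C * Y\<^sup>2"
      using C(2)[of Y "\<lambda>i. of_real Y * M $$ (i, i)"] Y YM by (simp add: sum_distrib_left)
    have T_other: "norm (T \<pi>) \<le> D ^ n * Y\<^sup>2" if \<pi>: "\<pi> permutes {0..<n}" "\<pi> \<noteq> id" for \<pi>
    proof -
      obtain i where i: "\<pi> i \<noteq> i" using \<pi>(2) by (auto simp: fun_eq_iff)
      define j where "j = \<pi> i"
      have inj: "inj \<pi>" using \<pi>(1) by (rule permutes_inj)
      have j: "\<pi> j \<noteq> j" using i inj by (auto simp: j_def inj_def)
      have ij: "i < n" "j < n" "i \<noteq> j"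
        using i j \<pi>(1) by (auto simp: permutes_def j_def)
      have \<pi>n: "\<pi> k < n" if "k < n" for k
        using permutes_in_image[OF \<pi>(1), of k] that by simp
      let ?w = "\<lambda>l k. if k = l then Y else 1 :: real"
      have "norm (T \<pi>) = (\<Prod>k = 0..<n. norm (A $$ (k, \<pi> k)))"
        by (simp add: T_def norm_mult prod_norm sign_def)
      also have "\<dots> \<le> (\<Prod>k = 0..<n. D * (?w i k * ?w j k))"
      proof (intro prod_mono conjI norm_ge_zero)
        fix k assume "k \<in> {0..<n}"
        then have k: "k < n" "\<pi> k < n" using \<pi>n by auto
        show "norm (A $$ (k, \<pi> k)) \<le> D * (?w i k * ?w j k)"
          using diag_le[OF k] off_le[OF k] i j ij by auto
      qed
      also have "\<dots> = D ^ n * Y\<^sup>2"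
        using ij by (simp add: prod.distrib power2_eq_square)
      finally show ?thesis .
    qed
    let ?P = "{\<pi>. \<pi> permutes {0..<n}}"
    have fin: "finite ?P" by (rule finite_permutations) simp
    have "Determinant.det A = sum T ?P" unfolding T_def by (rule det_def'[OF A])
    also have "\<dots> = T id + sum T (?P - {id})"
      using fin by (intro sum.remove) (auto simp: permutes_id)
    finally have "norm (Determinant.det A - (1 - of_real Y * (\<Sum>i<n. M $$ (i, i))))
        = norm ((T id - (1 - of_real Y * (\<Sum>i<n. M $$ (i, i)))) + sum T (?P - {id}))"
      by (simp add: algebra_simps)
    also have "\<dots> \<le> C * Y\<^sup>2 + (\<Sum>\<pi>\<in>?P - {id}. D ^ n * Y\<^sup>2)"
      by (intro norm_triangle_mono T_id sum_norm_le T_other) auto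
    also have "(\<Sum>\<pi>\<in>?P - {id}. D ^ n * Y\<^sup>2) \<le> (\<Sum>\<pi>\<in>?P. D ^ n * Y\<^sup>2)"
      using fin D by (intro sum_mono2) auto
    also have "\<dots> = real (fact n) * D ^ n * Y\<^sup>2"
      by (simp add: card_permutations)
    finally show "norm (Determinant.det (1\<^sub>m n - complex_of_real Y \<cdot>\<^sub>m M)
        - (1 - of_real Y * (\<Sum>i<n. M $$ (i, i)))) \<le> (C + real (fact n) * D ^ n) * Y\<^sup>2"
      by (simp add: A_def distrib_right)
  qed
qed

lemma coeff_linear_mult:
  "Polynomial.coeff ([:a, c:] * p) i =
     a * Polynomial.coeff p i + (case i of 0 \<Rightarrow> 0 | Suc k \<Rightarrow> c * Polynomial.coeff p k)"
  for p :: "complex poly"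
  by (cases i) auto

lemma norm_coeff_linear_mult_le:
  fixes p :: "complex poly"
  assumes "norm a \<le> 1" "norm c \<le> 1" "\<And>i. norm (Polynomial.coeff p i) \<le> A"
  shows "norm (Polynomial.coeff ([:a, c:] * p) i) \<le> 2 * A"
proof -
  have A: "A \<ge> 0" using assms(3)[of 0] norm_ge_zero order_trans by blast
  have le: "norm (x * Polynomial.coeff p k) \<le> A" if "norm x \<le> 1" for x k
    unfolding norm_mult using mult_mono[OF that assms(3)[of k]] by simp
  have "norm (case i of 0 \<Rightarrow> 0 | Suc k \<Rightarrow> c * Polynomial.coeff p k) \<le> A"
    using le[OF assms(2)] A by (cases i) auto
  with le[OF assms(1)] show ?thesis
    unfolding coeff_linear_mult mult_2 by (rule norm_triangle_mono)
qed

lemma continuous_on_coeff_linear_mult: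
  fixes P :: "'a::topological_space \<Rightarrow> complex poly"
  assumes "continuous_on S a" "continuous_on S c" "\<And>i. continuous_on S (\<lambda>x. Polynomial.coeff (P x) i)"
  shows "continuous_on S (\<lambda>x. Polynomial.coeff ([:a x, c x:] * P x) i)"
  unfolding coeff_linear_mult using assms by (cases i) (auto intro!: continuous_intros)

text \<open>The entries of symmetric powers, with independent exponents \<open>k\<close> and \<open>j\<close> in place of \<open>m - j\<close>
  and \<open>j\<close>, so that properties can be proved by induction on each exponent.\<close>
definition sym_entry :: "nat \<Rightarrow> nat \<Rightarrow> complex^2^2 \<Rightarrow> nat \<Rightarrow> complex" where
  "sym_entry k j g i = Polynomial.coeff ([:g $ 1 $ 1, g $ 2 $ 1:] ^ k * [:g $ 1 $ 2, g $ 2 $ 2:] ^ j) i"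

lemma norm_sym_entry_le:
  assumes "g \<in> SU2"
  shows "norm (sym_entry k j g i) \<le> 2 ^ (k + j)"
proof -
  note E = SU2_norm_entry_le[OF assms]
  have 1: "norm (Polynomial.coeff ([:g $ 1 $ 2, g $ 2 $ 2:] ^ j) i) \<le> 2 ^ j" for i
  proof (induction j arbitrary: i)
    case (Suc j)
    then show ?case using norm_coeff_linear_mult_le[OF E E Suc, of 1 2 2 2 i] by simp
  qed (simp add: coeff_1)
  show ?thesis unfolding sym_entry_def
  proof (induction k arbitrary: i)
    case (Suc k)
    then show ?case using norm_coeff_linear_mult_le[OF E E Suc, of 1 1 2 1 i]
      by (simp only: power_Suc add_Suc mult.assoc)
  qed (simp add: 1)
qed

lemma continuous_on_sym_entry: "continuous_on S (\<lambda>g. sym_entry k j g i)"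
proof -
  have 1: "continuous_on S (\<lambda>g :: complex^2^2. Polynomial.coeff ([:g $ 1 $ 2, g $ 2 $ 2:] ^ j) i)" for i
  proof (induction j arbitrary: i)
    case (Suc j)
    then show ?case unfolding power_Suc
      by (intro continuous_on_coeff_linear_mult continuous_intros)
  qed (simp add: coeff_1)
  show ?thesis unfolding sym_entry_def
  proof (induction k arbitrary: i)
    case (Suc k)
    then show ?case unfolding power_Suc mult.assoc
      by (intro continuous_on_coeff_linear_mult continuous_intros)
  qed (simp add: 1)
qed

lemma sym_rep_carrier: "sym_rep m g \<in> carrier_mat (m + 1) (m + 1)"
  by (simp add: sym_rep_def)

lemma sym_rep_entry:
  "i \<le> m \<Longrightarrow> j \<le> m \<Longrightarrow> sym_rep m g $$ (i, j) = sym_entry (m - j) j g i"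
  by (simp add: sym_rep_def sym_entry_def)

definition sym_det :: "nat \<Rightarrow> real \<Rightarrow> complex^2^2 \<Rightarrow> complex" where
  "sym_det m Y g = Determinant.det (1\<^sub>m (m + 1) - complex_of_real Y \<cdot>\<^sub>m sym_rep m g)"

lemma DD_sym_rep: "DD Y (sym_rep m) g = inverse (sym_det m Y g)"
  using sym_rep_carrier[of m g] by (simp add: DD_def sym_det_def)

lemma continuous_on_sym_det: "continuous_on S (sym_det m Y)"
proof -
  have "sym_det m Y g = (\<Sum>\<pi> | \<pi> permutes {0..<m + 1}. signof \<pi> *
      (\<Prod>i = 0..<m + 1. (if i = \<pi> i then 1 else 0) - of_real Y * sym_entry (m - \<pi> i) (\<pi> i) g i))" for g
    unfolding sym_det_def
  proof (subst det_def'[of _ "m + 1"])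
    show "1\<^sub>m (m + 1) - complex_of_real Y \<cdot>\<^sub>m sym_rep m g \<in> carrier_mat (m + 1) (m + 1)"
      by (intro minus_carrier_mat smult_carrier_mat sym_rep_carrier)
    have "(1\<^sub>m (m + 1) - complex_of_real Y \<cdot>\<^sub>m sym_rep m g) $$ (i, \<pi> i) =
        (if i = \<pi> i then 1 else 0) - of_real Y * sym_entry (m - \<pi> i) (\<pi> i) g i"
      if "\<pi> permutes {0..<m + 1}" "i \<in> {0..<m + 1}" for \<pi> i
    proof -
      have "\<pi> i \<in> {0..<m + 1}" using that permutes_in_image[OF that(1)] by blast
      then have "i \<le> m" "\<pi> i \<le> m" using that(2) by auto
      then show ?thesis using sym_rep_carrier[of m g] by (simp add: sym_rep_entry)
    qed
    then show "(\<Sum>\<pi> | \<pi> permutes {0..<m + 1}. signof \<pi> *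
        (\<Prod>i = 0..<m + 1. (1\<^sub>m (m + 1) - complex_of_real Y \<cdot>\<^sub>m sym_rep m g) $$ (i, \<pi> i))) =
        (\<Sum>\<pi> | \<pi> permutes {0..<m + 1}. signof \<pi> *
      (\<Prod>i = 0..<m + 1. (if i = \<pi> i then 1 else 0) - of_real Y * sym_entry (m - \<pi> i) (\<pi> i) g i))"
      by (intro sum.cong refl arg_cong2[of _ _ _ _ "(*)"] prod.cong) auto
  qed
  then have "sym_det m Y = (\<lambda>g. (\<Sum>\<pi> | \<pi> permutes {0..<m + 1}. signof \<pi> *
      (\<Prod>i = 0..<m + 1. (if i = \<pi> i then 1 else 0) - of_real Y * sym_entry (m - \<pi> i) (\<pi> i) g i)))"
    by (rule ext)
  then show ?thesis
    by (simp only:) (intro continuous_intros continuous_on_sym_entry)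
qed

definition sym_trace :: "nat \<Rightarrow> complex^2^2 \<Rightarrow> complex" where
  "sym_trace m g = (\<Sum>i\<le>m. sym_entry (m - i) i g i)"

lemma continuous_on_sym_trace: "continuous_on S (sym_trace m)"
  unfolding sym_trace_def by (intro continuous_intros continuous_on_sym_entry)

lemma norm_sym_trace_le:
  assumes "g \<in> SU2"
  shows "norm (sym_trace m g) \<le> real (m + 1) * 2 ^ m"
proof -
  have "norm (sym_trace m g) \<le> (\<Sum>i\<le>m. 2 ^ m)"
    unfolding sym_trace_def
  proof (rule sum_norm_le)
    fix i assume "i \<in> {..m}"
    then show "norm (sym_entry (m - i) i g i) \<le> 2 ^ m"
      using norm_sym_entry_le[OF assms, of "m - i" i i] by simp
  qed
  then show ?thesis by simp
qed

lemma sym_det_approx: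
  "\<exists>C\<ge>0. \<forall>g\<in>SU2. \<forall>Y. 0 \<le> Y \<and> Y \<le> 1 \<longrightarrow>
     norm (sym_det m Y g - (1 - of_real Y * sym_trace m g)) \<le> C * Y\<^sup>2"
proof (rule det_one_minus_smult_approx[of "2 ^ m" "m + 1"])
  show "(0::real) \<le> 2 ^ m" by simp
  fix C :: real
  assume C: "C \<ge> 0" "\<And>(M :: complex Matrix.mat) Y. M \<in> carrier_mat (m + 1) (m + 1) \<Longrightarrow>
      0 \<le> Y \<Longrightarrow> Y \<le> 1 \<Longrightarrow> (\<And>i j. i < m + 1 \<Longrightarrow> j < m + 1 \<Longrightarrow> norm (M $$ (i, j)) \<le> 2 ^ m) \<Longrightarrow>
      norm (Determinant.det (1\<^sub>m (m + 1) - complex_of_real Y \<cdot>\<^sub>m M)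
             - (1 - of_real Y * (\<Sum>i<m + 1. M $$ (i, i)))) \<le> C * Y\<^sup>2"
  have "norm (sym_det m Y g - (1 - of_real Y * sym_trace m g)) \<le> C * Y\<^sup>2"
    if g: "g \<in> SU2" and Y: "0 \<le> Y" "Y \<le> 1" for g Y
  proof -
    have "norm (sym_rep m g $$ (i, j)) \<le> 2 ^ m" if "i < m + 1" "j < m + 1" for i j
      using that norm_sym_entry_le[OF g, of "m - j" j i] by (simp add: sym_rep_entry)
    moreover have "sym_trace m g = (\<Sum>i<m + 1. sym_rep m g $$ (i, i))"
      unfolding sym_trace_def by (intro sum.cong) (auto simp: sym_rep_entry)
    ultimately show ?thesis
      unfolding sym_det_def using C(2)[OF sym_rep_carrier Y] by simp
  qed
  with C(1) show ?thesis by blast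
qed

text \<open>The character of the \<open>m\<close>-th symmetric power is the Chebyshev polynomial of the second kind in
  \<open>t/2\<close>.\<close>
lemma sym_trace_eq:
  assumes "g \<in> SU2" "t = complex_of_real (2 * Re (g $ 1 $ 1))"
  shows "sym_trace 1 g = t" "sym_trace 2 g = t\<^sup>2 - 1" "sym_trace 4 g = t ^ 4 - 3 * t\<^sup>2 + 1"
proof -
  define a b c d where "a = g $ 1 $ 1" and "b = g $ 1 $ 2" and "c = g $ 2 $ 1" and "d = g $ 2 $ 2"
  note defs = this
  note E = SU2_entries[OF assms(1)]
  have t: "t = a + d" using E(1) assms(2) by (simp add: defs complex_eq_iff)
  have bc: "b * c = a * d - 1" using E(3) by (simp add: defs algebra_simps)
  show "sym_trace 1 g = t"
    by (simp add: sym_trace_def sym_entry_def t defs)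
  have "sym_trace 2 g = a\<^sup>2 + (a * d + b * c) + d\<^sup>2"
    by (simp add: sym_trace_def sym_entry_def numeral_eq_Suc defs[symmetric])
  then show "sym_trace 2 g = t\<^sup>2 - 1"
    unfolding bc t by (simp add: power2_eq_square algebra_simps)
  have "sym_trace 4 g = a ^ 4 + (a ^ 3 * d + 3 * a\<^sup>2 * (b * c))
      + (a\<^sup>2 * d\<^sup>2 + 4 * (a * d) * (b * c) + (b * c)\<^sup>2) + (a * d ^ 3 + 3 * d\<^sup>2 * (b * c)) + d ^ 4"
    by (simp add: sym_trace_def sym_entry_def numeral_eq_Suc defs[symmetric] algebra_simps)
  then show "sym_trace 4 g = t ^ 4 - 3 * t\<^sup>2 + 1"
    unfolding bc t by (simp add: power2_eq_square power4_eq_xxxx power3_eq_cube algebra_simps)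
qed

section \<open>Local integrals at large primes\<close>

text \<open>The power is \<open>exp(-z Ln(1 + w))\<close>. The hypotheses on \<open>Y\<close> keep \<open>w\<close> in the disc of radius 1/2,
  where the logarithm is linear up to \<open>O(Y\<^sup>2)\<close>, and keep the exponent bounded, so that the
  exponential is linear up to \<open>O(\<bar>z\<bar>\<^sup>2 Y\<^sup>2)\<close>.\<close>
lemma inverse_powr_approx:
  fixes w \<tau> z :: complex and Y K T :: real
  assumes w: "norm (w + of_real Y * \<tau>) \<le> K * Y\<^sup>2" and \<tau>: "norm \<tau> \<le> T" and K: "K \<ge> 0"
    and Y: "0 \<le> Y" "Y \<le> 1" "(T + K) * Y < 1 / 2" and z: "norm z * Y \<le> 1"
  shows "norm (inverse (1 + w) powr z - (1 + z * of_real Y * \<tau>))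
    \<le> (2 * (T + K)\<^sup>2 + K + 4 * (T + K)\<^sup>2 * exp (2 * (T + K))) * ((1 + norm z)\<^sup>2 * Y\<^sup>2)"
proof -
  define D where "D = T + K"
  have T: "T \<ge> 0" using \<tau> norm_ge_zero order_trans by blast
  have D: "D \<ge> 0" "K \<le> D" using T K by (auto simp: D_def)
  have "norm w \<le> norm (w + of_real Y * \<tau>) + norm (of_real Y * \<tau>)"
    using norm_triangle_ineq4[of "w + of_real Y * \<tau>" "of_real Y * \<tau>"] by simp
  also have "norm (of_real Y * \<tau>) \<le> Y * T"
    using Y(1) \<tau> by (simp add: norm_mult mult_left_mono)
  also have "norm (w + of_real Y * \<tau>) \<le> K * Y"
    using w mult_left_mono[of "Y\<^sup>2" Y K] K Y mult_left_mono[of Y 1 Y] by (simp add: power2_eq_square)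
  finally have wD: "norm w \<le> D * Y" by (simp add: D_def algebra_simps)
  have w_half: "norm w < 1 / 2" using wD Y(3) by (simp add: D_def)
  have w2: "(norm w)\<^sup>2 \<le> D\<^sup>2 * Y\<^sup>2" using wD power_mono[of "norm w" "D * Y" 2] by (simp add: power_mult_distrib)
  have Re: "Re (1 + w) > 0"
    using abs_Re_le_cmod[of w] w_half by simp
  then have nr: "1 + w \<notin> \<real>\<^sub>\<le>\<^sub>0" by (auto simp: complex_nonpos_Reals_iff)
  then have nz: "1 + w \<noteq> 0" by (metis nonpos_Reals_zero_I)
  define y where "y = - (z * Ln (1 + w))"
  have V: "inverse (1 + w) powr z = exp y"
    using nz nr by (simp add: powr_def Ln_inverse y_def)
  have "norm (Ln (1 + w) - w) \<le> (norm w)\<^sup>2 / (1 - norm w)"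
    using w_half by (intro Ln_approx_linear) auto
  also have "\<dots> \<le> (norm w)\<^sup>2 / (1 / 2)"
    using w_half by (intro divide_left_mono) auto
  also have "\<dots> \<le> 2 * (D\<^sup>2 * Y\<^sup>2)" using w2 by simp
  finally have Ln: "norm (Ln (1 + w) - w) \<le> 2 * (D\<^sup>2 * Y\<^sup>2)" .
  have "norm (y - z * of_real Y * \<tau>) = norm z * norm ((Ln (1 + w) - w) + (w + of_real Y * \<tau>))"
    unfolding norm_mult[symmetric] y_def by (subst norm_minus_cancel[symmetric]) (simp add: algebra_simps)
  also have "\<dots> \<le> norm z * (2 * (D\<^sup>2 * Y\<^sup>2) + K * Y\<^sup>2)"
    by (intro mult_left_mono norm_triangle_mono Ln w) auto
  also have "\<dots> = norm z * ((2 * D\<^sup>2 + K) * Y\<^sup>2)" by (simp add: algebra_simps)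
  also have "\<dots> \<le> (1 + norm z)\<^sup>2 * ((2 * D\<^sup>2 + K) * Y\<^sup>2)"
  proof (rule mult_right_mono)
    show "norm z \<le> (1 + norm z)\<^sup>2" by (simp add: power2_eq_square algebra_simps)
  qed (use K in simp)
  finally have 1: "norm (y - z * of_real Y * \<tau>) \<le> (1 + norm z)\<^sup>2 * ((2 * D\<^sup>2 + K) * Y\<^sup>2)" .
  have "norm y \<le> norm z * (2 * norm w)"
    unfolding y_def norm_minus_cancel norm_mult using w_half by (intro mult_left_mono norm_Ln_le) auto
  also have "\<dots> \<le> norm z * (2 * (D * Y))" using wD by (intro mult_left_mono) auto
  finally have y: "norm y \<le> 2 * D * (norm z * Y)" by (simp add: algebra_simps)
  also have "\<dots> \<le> 2 * D * 1" using D z by (intro mult_left_mono) auto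
  finally have y_le: "norm y \<le> 2 * D" by simp
  have "norm (exp y - (\<Sum>i\<le>1. y ^ i / fact i)) \<le> exp (norm y) * norm y ^ Suc 1 / fact 1"
    by (rule Taylor_exp_field)
  also have "(\<Sum>i\<le>1. y ^ i / fact i) = 1 + y" by simp
  also have "exp (norm y) * norm y ^ Suc 1 / fact 1 = exp (norm y) * (norm y)\<^sup>2"
    by (simp add: power2_eq_square)
  also have "\<dots> \<le> exp (2 * D) * (2 * D * (norm z * Y))\<^sup>2"
    using y y_le by (intro mult_mono power_mono) auto
  also have "\<dots> = 4 * D\<^sup>2 * exp (2 * D) * ((norm z)\<^sup>2 * Y\<^sup>2)"
    by (simp add: power_mult_distrib)
  also have "\<dots> \<le> 4 * D\<^sup>2 * exp (2 * D) * ((1 + norm z)\<^sup>2 * Y\<^sup>2)"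
    by (intro mult_left_mono mult_right_mono power_mono) auto
  finally have 2: "norm (exp y - (1 + y)) \<le> 4 * D\<^sup>2 * exp (2 * D) * ((1 + norm z)\<^sup>2 * Y\<^sup>2)" .
  have "norm (exp y - (1 + z * of_real Y * \<tau>)) \<le>
      4 * D\<^sup>2 * exp (2 * D) * ((1 + norm z)\<^sup>2 * Y\<^sup>2) + (1 + norm z)\<^sup>2 * ((2 * D\<^sup>2 + K) * Y\<^sup>2)"
    using norm_triangle_mono[OF 2 1] by (simp add: algebra_simps)
  then show ?thesis unfolding V D_def[symmetric] by (simp add: algebra_simps)
qed

lemma det_2x2:
  assumes "A \<in> carrier_mat 2 2"
  shows "Determinant.det A = A $$ (0,0) * A $$ (1,1) - A $$ (1,0) * A $$ (0,1)"
proof -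
  have "Determinant.det (mat_delete A i 0) = mat_delete A i 0 $$ (0, 0)" if "i < 2" for i
    using assms mat_delete_carrier[of A 2 2 i 0] by (intro det_single) simp
  then show ?thesis using assms
    by (subst laplace_expansion_column[OF assms, of 0])
       (auto simp: cofactor_def numeral_2_eq_2 mat_delete_def)
qed

lemma DD_std_rep:
  assumes "g \<in> SU2"
  shows "DD X std_rep g = inverse (1 - of_real (2 * Re (g $ 1 $ 1)) * of_real X + (of_real X)\<^sup>2)"
proof -
  define a b c d where "a = g $ 1 $ 1" and "b = g $ 1 $ 2" and "c = g $ 2 $ 1" and "d = g $ 2 $ 2"
  note defs = this
  note E = SU2_entries[OF assms]
  have t: "of_real (2 * Re (g $ 1 $ 1)) = a + d" using E(1) by (simp add: defs complex_eq_iff)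
  have bc: "b * c = a * d - 1" using E(3) by (simp add: defs algebra_simps)
  have carr: "std_rep g \<in> carrier_mat 2 2"
    by (simp add: std_rep_def mat_of_rows_list_def numeral_2_eq_2)
  have "Determinant.det (1\<^sub>m 2 - complex_of_real X \<cdot>\<^sub>m std_rep g)
      = (1 - of_real X * a) * (1 - of_real X * d) - (of_real X * c) * (of_real X * b)"
    by (subst det_2x2) (auto simp: std_rep_def mat_of_rows_list_def defs)
  also have "\<dots> = 1 - (a + d) * of_real X + (a * d - b * c) * (of_real X)\<^sup>2"
    by (simp add: algebra_simps power2_eq_square)
  also have "\<dots> = 1 - (a + d) * of_real X + (of_real X)\<^sup>2" unfolding bc by simp
  finally show ?thesis using carr unfolding DD_def t by simp
qed

text \<open>The product of \<open>1 - t X + X\<^sup>2\<close> with the quadratic approximation differs from 1 by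
  \<open>O(X\<^sup>3)\<close>, and \<open>1 - t X + X\<^sup>2\<close> is bounded away from 0.\<close>
lemma inverse_quadratic_approx:
  fixes t :: complex and X :: real
  assumes t: "norm t \<le> 2" and X: "0 \<le> X" "X \<le> 1 / 4"
  shows "1 - t * of_real X + (of_real X)\<^sup>2 \<noteq> 0" (is "?q \<noteq> 0")
    and "norm (inverse (1 - t * of_real X + (of_real X)\<^sup>2)
      - (1 + t * of_real X + (t\<^sup>2 - 1) * (of_real X)\<^sup>2)) \<le> 34 * X ^ 3"
proof -
  have tX: "norm (t * of_real X) \<le> 1 / 2"
    using mult_mono[of "norm t" 2 X "1 / 4"] t X by (simp add: norm_mult)
  have X2: "norm ((of_real X)\<^sup>2 :: complex) \<le> 1 / 16"
    using power_mono[OF X(2,1), of 2] unfolding norm_power by (simp add: power_divide)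
  have "norm (1 :: complex) \<le> norm ?q + (norm (t * of_real X) + norm ((of_real X)\<^sup>2 :: complex))"
    using norm_triangle_ineq[of ?q "t * of_real X - (of_real X)\<^sup>2"]
      norm_triangle_ineq4[of "t * of_real X" "(of_real X)\<^sup>2"] by (simp add: algebra_simps)
  then have q: "norm ?q \<ge> 7 / 16" using tX X2 by simp
  then show nz: "?q \<noteq> 0" by auto
  have t2: "norm (t\<^sup>2) \<le> 4" "norm (t ^ 3) \<le> 8"
    using power_mono[OF t norm_ge_zero, of 2] power_mono[OF t norm_ge_zero, of 3]
    by (simp_all add: norm_power)
  let ?r = "(2 * t - t ^ 3) + (t\<^sup>2 - 1) * of_real X"
  have "norm ?r \<le> (norm (2 * t) + norm (t ^ 3)) + norm ((t\<^sup>2 - 1) * of_real X)"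
    by (intro norm_triangle_mono norm_triangle_ineq4 order_refl)
  also have "norm ((t\<^sup>2 - 1) * of_real X) \<le> 5 * (1 / 4)"
    unfolding norm_mult using t2 X norm_triangle_ineq4[of "t\<^sup>2" 1] by (intro mult_mono) auto
  finally have r: "norm ?r \<le> 14" using t t2 by (simp add: norm_mult)
  have "inverse ?q - (1 + t * of_real X + (t\<^sup>2 - 1) * (of_real X)\<^sup>2)
      = (1 - ?q * (1 + t * of_real X + (t\<^sup>2 - 1) * (of_real X)\<^sup>2)) / ?q"
    using nz by (simp add: field_simps)
  also have "1 - ?q * (1 + t * of_real X + (t\<^sup>2 - 1) * (of_real X)\<^sup>2) = - (of_real X ^ 3 * ?r)"
    by (simp add: algebra_simps power2_eq_square power3_eq_cube)
  also have "norm (- (of_real X ^ 3 * ?r) / ?q) = X ^ 3 * norm ?r / norm ?q"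
    using X by (simp add: norm_divide norm_mult norm_power)
  also have "\<dots> \<le> X ^ 3 * 14 / (7 / 16)"
    using r q X by (intro frac_le mult_mono) auto
  also have "\<dots> \<le> 34 * X ^ 3" using X by simp
  finally show "norm (inverse ?q - (1 + t * of_real X + (t\<^sup>2 - 1) * (of_real X)\<^sup>2)) \<le> 34 * X ^ 3" .
qed

text \<open>The trivial representation does not occur in the symmetric powers of degree 1, 2 and 4. Here the
  integrals are read off from the moments: the mean of \<open>t\<^sup>2\<close> is 1 and that of \<open>t\<^sup>4\<close> is 2.\<close>
lemma haar_character_integrals:
  assumes haar: "haar_SU2 \<mu>" and m: "m \<in> {1, 2, 4}"
  defines "t \<equiv> \<lambda>g :: complex^2^2. complex_of_real (2 * Re (g $ 1 $ 1))"
  shows "(LINT g|\<mu>. t g) = 0" "(LINT g|\<mu>. (t g)\<^sup>2 - 1) = 0" "(LINT g|\<mu>. sym_trace m g) = 0"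
proof -
  interpret prob_space \<mu> using haar by (simp add: haar_SU2_def)
  let ?x = "\<lambda>g :: complex^2^2. Re (g $ 1 $ 1)"
  have int: "integrable \<mu> ?x" "integrable \<mu> (\<lambda>g. (?x g)\<^sup>2)" "integrable \<mu> (\<lambda>g. ?x g ^ 4)"
    by (intro haar_integrable[OF haar] continuous_intros)+
  have sp: "space \<mu> = SU2" using haar by (simp add: haar_SU2_def)
  show 1: "(LINT g|\<mu>. t g) = 0"
    unfolding t_def using haar_moments(1)[OF haar] by (simp add: integral_complex_of_real)
  have "(LINT g|\<mu>. (t g)\<^sup>2 - 1) = (LINT g|\<mu>. complex_of_real (4 * (?x g)\<^sup>2 - 1))"
    by (simp add: t_def power_mult_distrib)
  also have "(LINT g|\<mu>. complex_of_real (4 * (?x g)\<^sup>2 - 1)) = 0"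
  proof -
    have "(LINT g|\<mu>. 4 * (?x g)\<^sup>2 - 1) = 0"
      using haar_moments(2)[OF haar] int by (simp add: prob_space)
    then show ?thesis unfolding integral_complex_of_real by simp
  qed
  finally show 2: "(LINT g|\<mu>. (t g)\<^sup>2 - 1) = 0" .
  have "(LINT g|\<mu>. (t g) ^ 4 - 3 * (t g)\<^sup>2 + 1) =
      (LINT g|\<mu>. complex_of_real (16 * ?x g ^ 4 - 12 * (?x g)\<^sup>2 + 1))"
    by (simp add: t_def power_mult_distrib)
  also have "(LINT g|\<mu>. complex_of_real (16 * ?x g ^ 4 - 12 * (?x g)\<^sup>2 + 1)) = 0"
  proof -
    have "(LINT g|\<mu>. 16 * ?x g ^ 4 - 12 * (?x g)\<^sup>2 + 1) = 0"
      using haar_moments(2,3)[OF haar] int by (simp add: prob_space)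
    then show ?thesis unfolding integral_complex_of_real by simp
  qed
  finally have 4: "(LINT g|\<mu>. (t g) ^ 4 - 3 * (t g)\<^sup>2 + 1) = 0" .
  have cong: "(LINT g|\<mu>. sym_trace m g) = (LINT g|\<mu>. F g)" if "\<And>g. g \<in> SU2 \<Longrightarrow> sym_trace m g = F g" for F
    by (intro Bochner_Integration.integral_cong) (auto simp: sp that)
  show "(LINT g|\<mu>. sym_trace m g) = 0"
    using m
  proof (elim insertE emptyE)
    assume "m = 1" then show ?thesis
      using cong[of t] sym_trace_eq(1) 1 by (simp add: t_def)
  next
    assume "m = 2" then show ?thesis
      using cong[of "\<lambda>g. (t g)\<^sup>2 - 1"] sym_trace_eq(2) 2 by (simp add: t_def)
  next
    assume "m = 4" then show ?thesis
      using cong[of "\<lambda>g. (t g) ^ 4 - 3 * (t g)\<^sup>2 + 1"] sym_trace_eq(3) 4 by (simp add: t_def)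
  qed
qed

text \<open>The first two terms \<open>t X + (t\<^sup>2 - 1) X\<^sup>2\<close> of the factor for the standard representation and the
  first term \<open>z \<chi> X\<^sup>2\<close> of the other factor have mean zero. The largest remaining terms are of
  order \<open>X\<^sup>3\<close> from the first factor, \<open>t X \<cdot> z \<chi> X\<^sup>2\<close> from the mixed product, and
  \<open>(1 + \<bar>z\<bar>)\<^sup>2 X\<^sup>4\<close> from the second, where \<open>X = p\<^sup>-\<^sup>1\<^sup>/\<^sup>2\<close>. The condition
  \<open>1 + \<bar>z\<bar> \<le> p\<close> makes the second factor bounded.\<close>
lemma local_int_approx:
  assumes haar: "haar_SU2 \<mu>" and m: "m \<in> {1, 2, 4}"
  shows "\<exists>P0 C. C \<ge> 0 \<and> (\<forall>p z. P0 \<le> real p \<and> 1 + norm z \<le> real p \<longrightarrow>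
     norm (local_int \<mu> m z p - 1)
       \<le> C * ((1 + norm z) * real p powr (- (3/2)) + (1 + norm z)\<^sup>2 * real p powr (- 2)))"
proof -
  interpret prob_space \<mu> using haar by (simp add: haar_SU2_def)
  have sp: "space \<mu> = SU2" using haar by (simp add: haar_SU2_def)
  obtain K where K: "K \<ge> 0" "\<And>g Y. g \<in> SU2 \<Longrightarrow> 0 \<le> Y \<Longrightarrow> Y \<le> 1 \<Longrightarrow>
      norm (sym_det m Y g - (1 - of_real Y * sym_trace m g)) \<le> K * Y\<^sup>2"
    using sym_det_approx[of m] by blast
  define T where "T = real (m + 1) * 2 ^ m"
  have T: "T \<ge> 0" by (simp add: T_def)
  define C where "C = 2 * (T + K)\<^sup>2 + K + 4 * (T + K)\<^sup>2 * exp (2 * (T + K))"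
  have C: "C \<ge> 0" using K T by (simp add: C_def)
  define C' where "C' = 34 * (1 + T + C) + 2 * C + 4 * T"
  have bound: "norm (local_int \<mu> m z p - 1)
       \<le> C' * ((1 + norm z) * real p powr (- (3/2)) + (1 + norm z)\<^sup>2 * real p powr (- 2))"
    if p: "max 16 (2 * (T + K) + 1) \<le> real p" and zp: "1 + norm z \<le> real p" for p z
  proof -
    define X where "X = real p powr (- 1 / 2)"
    define Y where "Y = 1 / real p"
    define Z where "Z = 1 + norm z"
    have p0: "real p \<ge> 16" "real p > 0" using p by auto
    have X_pow: "X ^ k = real p powr (real k * (- 1 / 2))" for k
      unfolding X_def using p0 by (intro powr_power) auto
    have X_sq: "X\<^sup>2 = Y" unfolding X_pow Y_def using p0 by (simp add: powr_minus_divide)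
    have X0: "X > 0" using p0 by (simp add: X_def)
    have "X\<^sup>2 \<le> (1 / 4)\<^sup>2" unfolding X_sq Y_def using p0 by (simp add: power2_eq_square field_simps)
    then have X: "0 \<le> X" "X \<le> 1 / 4" using X0 by (auto intro: power2_le_imp_le)
    have X3: "X ^ 3 = real p powr (- (3/2))" unfolding X_pow by simp
    have X4: "X ^ 4 = real p powr (- 2)" "X ^ 4 = Y\<^sup>2"
      using power_mult[of X 2 2] by (simp add: X_pow, simp add: X_sq)
    have Y: "0 \<le> Y" "Y \<le> 1" "(T + K) * Y < 1 / 2" "norm z * Y \<le> 1" "Z * Y \<le> 1"
      using p p0 zp by (auto simp: Y_def Z_def field_simps)
    have Z: "Z \<ge> 1" "norm z \<le> Z" by (auto simp: Z_def)
    define t where "t = (\<lambda>g :: complex^2^2. complex_of_real (2 * Re (g $ 1 $ 1)))"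
    define U where "U = (\<lambda>g. inverse (1 - t g * of_real X + (of_real X)\<^sup>2))"
    define V where "V = (\<lambda>g. inverse (sym_det m Y g) powr z)"
    define P where "P = (\<lambda>g. of_real X * t g + (of_real X)\<^sup>2 * ((t g)\<^sup>2 - 1) + z * of_real Y * sym_trace m g)"
    have t2: "norm (t g) \<le> 2" if "g \<in> SU2" for g
      using SU2_norm_entry_le[OF that, of 1 1] abs_Re_le_cmod[of "g $ 1 $ 1"] by (simp add: t_def norm_mult)
    have w: "norm ((sym_det m Y g - 1) + of_real Y * sym_trace m g) \<le> K * Y\<^sup>2"
      and \<tau>: "norm (sym_trace m g) \<le> T" if "g \<in> SU2" for g
      using K(2)[OF that Y(1,2)] norm_sym_trace_le[OF that, of m]
      by (simp_all add: T_def algebra_simps)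
    \<comment> \<open>\<open>P\<close> collects the terms of mean zero.\<close>
    have close: "norm (U g * V g - (1 + P g)) \<le> C' * (Z * X ^ 3 + Z\<^sup>2 * X ^ 4)" if g: "g \<in> SU2" for g
    proof -
      define A where "A = 1 + t g * of_real X + ((t g)\<^sup>2 - 1) * (of_real X)\<^sup>2"
      define s where "s = z * of_real Y * sym_trace m g"
      have r: "norm (U g - A) \<le> 34 * X ^ 3"
        unfolding U_def A_def by (rule inverse_quadratic_approx(2)[OF t2[OF g] X])
      have v: "norm (V g - (1 + s)) \<le> C * (Z\<^sup>2 * Y\<^sup>2)"
        using inverse_powr_approx[OF w[OF g] \<tau>[OF g] K(1) Y(1-4)]
        by (simp add: V_def s_def C_def Z_def)
      have "norm s = norm z * Y * norm (sym_trace m g)" using Y(1) by (simp add: s_def norm_mult)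
      also have "\<dots> \<le> Z * Y * T" using Z Y(1) \<tau>[OF g] by (intro mult_mono) auto
      finally have s: "norm s \<le> Z * Y * T" .
      have "norm (A - 1) \<le> norm (t g * of_real X) + norm (((t g)\<^sup>2 - 1) * (of_real X)\<^sup>2)"
        unfolding A_def by (rule order_trans[OF _ norm_triangle_ineq]) simp
      also have "norm (t g * of_real X) \<le> 2 * X"
        using t2[OF g] X by (simp add: norm_mult mult_right_mono)
      also have "norm (((t g)\<^sup>2 - 1) * (of_real X)\<^sup>2) \<le> 5 * (1 / 4 * X)"
      proof -
        have "norm ((t g)\<^sup>2) \<le> 4" using power_mono[OF t2[OF g] norm_ge_zero, of 2] by (simp add: norm_power)
        then have "norm ((t g)\<^sup>2 - 1) \<le> 5" using norm_triangle_ineq4[of "(t g)\<^sup>2" 1] by simp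
        moreover have "norm ((of_real X)\<^sup>2 :: complex) \<le> 1 / 4 * X"
          using mult_right_mono[OF X(2,1)] unfolding norm_power by (simp add: power2_eq_square)
        ultimately show ?thesis unfolding norm_mult by (intro mult_mono) auto
      qed
      finally have A1: "norm (A - 1) \<le> 4 * X" using X by simp
      have A: "norm A \<le> 2" using norm_triangle_ineq[of "A - 1" 1] A1 X by simp
      have "norm (V g) \<le> norm (V g - (1 + s)) + (norm (1::complex) + norm s)"
        using norm_triangle_ineq[of "V g - (1 + s)" "1 + s"] norm_triangle_ineq[of 1 s] by simp
      also have "\<dots> \<le> C * 1 + (1 + 1 * T)"
      proof -
        have "C * (Z\<^sup>2 * Y\<^sup>2) \<le> C * 1"
          using Y Z C power_mono[OF Y(5), of 2] by (intro mult_left_mono) (auto simp: power_mult_distrib)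
        moreover have "Z * Y * T \<le> 1 * T" using Y(5) T by (intro mult_right_mono)
        ultimately show ?thesis using v s by simp
      qed
      finally have V: "norm (V g) \<le> 1 + T + C" by simp
      have "U g * V g - (1 + P g) = (U g - A) * V g + A * (V g - (1 + s)) + (A - 1) * s"
        by (simp add: P_def A_def s_def algebra_simps)
      also have "norm \<dots> \<le> 34 * X ^ 3 * (1 + T + C) + 2 * (C * (Z\<^sup>2 * Y\<^sup>2)) + 4 * X * (Z * Y * T)"
        by (intro norm_triangle_mono; unfold norm_mult; intro mult_mono r V v s A A1)
           (use X Z Y C T in auto)
      also have "\<dots> = 34 * (1 + T + C) * (1 * X ^ 3) + 2 * C * (Z\<^sup>2 * X ^ 4) + 4 * T * (Z * X ^ 3)"
        unfolding X4(2) X_sq[symmetric] by (simp add: power2_eq_square power3_eq_cube algebra_simps)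
      also have "\<dots> \<le> 34 * (1 + T + C) * (Z * X ^ 3 + Z\<^sup>2 * X ^ 4) + 2 * C * (Z * X ^ 3 + Z\<^sup>2 * X ^ 4)
          + 4 * T * (Z * X ^ 3 + Z\<^sup>2 * X ^ 4)"
      proof (intro add_mono mult_left_mono)
        have "1 * X ^ 3 \<le> Z * X ^ 3" using Z X by (intro mult_right_mono) auto
        moreover have "0 \<le> Z * X ^ 3" "0 \<le> Z\<^sup>2 * X ^ 4" using Z X by auto
        ultimately show "1 * X ^ 3 \<le> Z * X ^ 3 + Z\<^sup>2 * X ^ 4" "Z\<^sup>2 * X ^ 4 \<le> Z * X ^ 3 + Z\<^sup>2 * X ^ 4"
          "Z * X ^ 3 \<le> Z * X ^ 3 + Z\<^sup>2 * X ^ 4" by linarith+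
      qed (use C T in auto)
      also have "\<dots> = C' * (Z * X ^ 3 + Z\<^sup>2 * X ^ 4)" by (simp add: C'_def algebra_simps)
      finally show ?thesis .
    qed
    have t_cont: "continuous_on SU2 t" unfolding t_def by (intro continuous_intros)
    have U_cont: "continuous_on SU2 U"
      unfolding U_def using inverse_quadratic_approx(1)[OF t2 X]
      by (intro continuous_intros t_cont) auto
    have Re_sym_det: "Re (sym_det m Y g) > 0" if "g \<in> SU2" for g
    proof -
      have "norm (sym_det m Y g - 1) \<le> norm ((sym_det m Y g - 1) + of_real Y * sym_trace m g)
          + norm (of_real Y * sym_trace m g)"
        using norm_triangle_ineq4[of "(sym_det m Y g - 1) + of_real Y * sym_trace m g"
          "of_real Y * sym_trace m g"] by simp
      also have "norm (of_real Y * sym_trace m g) \<le> Y * T"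
        using Y(1) \<tau>[OF that] by (simp add: norm_mult mult_left_mono)
      also have "norm ((sym_det m Y g - 1) + of_real Y * sym_trace m g) \<le> K * Y"
        using w[OF that] mult_left_mono[of "Y\<^sup>2" Y K] K(1) Y mult_left_mono[of Y 1 Y]
        by (simp add: power2_eq_square)
      finally have "norm (sym_det m Y g - 1) < 1 / 2" using Y(3) by (simp add: algebra_simps)
      then show ?thesis using abs_Re_le_cmod[of "sym_det m Y g - 1"] by simp
    qed
    have nz: "sym_det m Y g \<noteq> 0" if "g \<in> SU2" for g
      using Re_sym_det[OF that] by (metis less_irrefl zero_complex.sel(1))
    have V_cont: "continuous_on SU2 V"
      unfolding V_def
    proof (rule continuous_on_powr_complex)
      show "SU2 \<subseteq> {g. 0 \<le> Re (inverse (sym_det m Y g)) \<or> Im (inverse (sym_det m Y g)) \<noteq> 0}"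
        using less_imp_le[OF Re_sym_det] by auto
      show "continuous_on SU2 (\<lambda>g. inverse (sym_det m Y g))"
        using nz by (intro continuous_on_inverse continuous_on_sym_det) auto
      show "0 < Re z" if "g \<in> SU2" "inverse (sym_det m Y g) = 0" for g
        using that nz[of g] by simp
    qed (rule continuous_on_const)
    have P_int: "(LINT g|\<mu>. P g) = 0"
    proof -
      have I: "(LINT g|\<mu>. t g) = 0" "(LINT g|\<mu>. (t g)\<^sup>2 - 1) = 0" "(LINT g|\<mu>. sym_trace m g) = 0"
        unfolding t_def by (rule haar_character_integrals[OF haar m])+
      have int: "integrable \<mu> t" "integrable \<mu> (\<lambda>g. (t g)\<^sup>2 - 1)" "integrable \<mu> (sym_trace m)"
        by (intro haar_integrable[OF haar] continuous_intros t_cont continuous_on_sym_trace)+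
      show ?thesis unfolding P_def using int I by simp
    qed
    have P_cont: "continuous_on SU2 P"
      unfolding P_def by (intro continuous_intros t_cont continuous_on_sym_trace)
    have UV_cont: "continuous_on SU2 (\<lambda>g. U g * V g)" by (intro continuous_intros U_cont V_cont)
    have int: "integrable \<mu> (\<lambda>g. U g * V g)" "integrable \<mu> P"
      by (intro haar_integrable[OF haar] UV_cont P_cont)+
    have "local_int \<mu> m z p = (LINT g|\<mu>. U g * V g)"
      unfolding local_int_def
      by (intro Bochner_Integration.integral_cong refl)
         (simp add: sp DD_std_rep DD_sym_rep U_def V_def t_def X_def Y_def)
    then have "local_int \<mu> m z p - 1 = (LINT g|\<mu>. U g * V g - (1 + P g))"
      using int P_int by (simp add: prob_space)
    also have "norm \<dots> \<le> (LINT g|\<mu>. norm (U g * V g - (1 + P g)))"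
      by (rule integral_norm_bound)
    also have "\<dots> \<le> C' * (Z * X ^ 3 + Z\<^sup>2 * X ^ 4)"
      using int by (intro integral_le_const) (auto simp: sp close)
    finally show ?thesis unfolding X3 X4(1) Z_def .
  qed
  have "C' \<ge> 0" using C T by (simp add: C'_def)
  with bound show ?thesis by blast
qed

section \<open>The uniform comparison\<close>

lemma convergent_prod_local_int:
  assumes haar: "haar_SU2 \<mu>" and m: "m \<in> {1, 2, 4}"
  shows "convergent_prod (\<lambda>p. if Q p then local_int \<mu> m z p else 1)"
proof -
  obtain P0 C where C: "C \<ge> 0" "\<And>p z. P0 \<le> real p \<Longrightarrow> 1 + norm z \<le> real p \<Longrightarrow>
     norm (local_int \<mu> m z p - 1)
       \<le> C * ((1 + norm z) * real p powr (- (3/2)) + (1 + norm z)\<^sup>2 * real p powr (- 2))"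
    using local_int_approx[OF haar m] by blast
  define Z where "Z = 1 + norm z"
  let ?f = "\<lambda>p. if Q p then local_int \<mu> m z p else 1"
  have "summable (\<lambda>p. C * (Z * real p powr (- (3/2)) + Z\<^sup>2 * real p powr (- 2)))"
    by (intro summable_mult summable_add) (simp_all add: summable_real_powr_iff)
  moreover have "\<forall>\<^sub>F p in sequentially. norm (norm (?f p - 1))
      \<le> C * (Z * real p powr (- (3/2)) + Z\<^sup>2 * real p powr (- 2))"
  proof -
    have "\<forall>\<^sub>F p in sequentially. max P0 Z \<le> real p"
      using filterlim_real_sequentially unfolding filterlim_at_top by blast
    then show ?thesis
    proof eventually_elim
      case (elim p)
      then have "norm (local_int \<mu> m z p - 1)
          \<le> C * (Z * real p powr (- (3/2)) + Z\<^sup>2 * real p powr (- 2))"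
        unfolding Z_def by (intro C(2)) simp_all
      moreover have "0 \<le> C * (Z * real p powr (- (3/2)) + Z\<^sup>2 * real p powr (- 2))"
        using C(1) by (simp add: Z_def)
      ultimately show ?case by (cases "Q p") simp_all
    qed
  qed
  ultimately have "summable (\<lambda>p. norm (?f p - 1))"
    by (rule summable_comparison_test_ev[rotated])
  then show ?thesis
    by (intro abs_convergent_prod_imp_convergent_prod) (simp add: abs_convergent_prod_conv_summable)
qed

text \<open>\<open>H\<close> is the common product over the primes not dividing \<open>N\<close>. It may vanish, so it is not
  divided out.\<close>
lemma L_level_eq:
  assumes haar: "haar_SU2 \<mu>" and m: "m \<in> {1, 2, 4}" and N: "N > 0"
  obtains H where "L_level \<mu> m z N = X_factor m z N * H"
    and "L_limit \<mu> m z = (\<Prod>p\<in>prime_factors N. local_int \<mu> m z p) * H"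
proof -
  let ?f = "\<lambda>Q p. if Q p then local_int \<mu> m z p else 1"
  let ?P = "\<lambda>p. p \<in> prime_factors N" and ?Q = "\<lambda>p. prime p \<and> \<not> p dvd N"
  have "prodinf (?f ?P) = (\<Prod>p\<in>prime_factors N. ?f ?P p)"
    by (intro prodinf_finite) auto
  then have P: "prodinf (?f ?P) = (\<Prod>p\<in>prime_factors N. local_int \<mu> m z p)" by simp
  have "L_limit \<mu> m z = (\<Prod>p. ?f ?P p * ?f ?Q p)"
    unfolding L_limit_def
  proof (rule prodinf_cong)
    fix p
    show "(if prime p then local_int \<mu> m z p else 1) = ?f ?P p * ?f ?Q p"
      using N prime_factors_dvd[of N] by auto
  qed
  also have "\<dots> = prodinf (?f ?P) * prodinf (?f ?Q)"
    by (intro prodinf_mult[symmetric] convergent_prod_local_int[OF haar m])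
  finally show ?thesis using P by (intro that[of "prodinf (?f ?Q)"]) (auto simp: L_level_def)
qed

text \<open>Each term of the maximum controls one of the error terms at a prime \<open>w\<close>: \<open>\<omega>\<close> controls
  \<open>w\<^sup>-\<^sup>1\<close>, \<open>(Z \<omega>)\<^sup>2\<^sup>/\<^sup>3\<close> controls \<open>Z w\<^sup>-\<^sup>3\<^sup>/\<^sup>2\<close>, and \<open>Z \<omega>\<^sup>1\<^sup>/\<^sup>2\<close> controls \<open>Z\<^sup>2 w\<^sup>-\<^sup>2\<close>. The
  common bound \<open>1/(x \<omega>)\<close> becomes \<open>1/x\<close> after summation over \<open>\<omega>\<close> primes.\<close>
lemma prime_factor_terms_le:
  fixes w x \<omega> Z :: real
  assumes x: "x \<ge> 1" and \<omega>: "\<omega> \<ge> 1" and Z: "Z \<ge> 1"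
    and w: "w \<ge> x * Max {\<omega>, (Z * \<omega>) powr (2/3), Z * \<omega> powr (1/2)}"
  shows "w \<ge> x" "w \<ge> Z" "w powr (- 1) \<le> 1 / (x * \<omega>)"
    "Z * w powr (- (3/2)) \<le> 1 / (x * \<omega>)" "Z\<^sup>2 * w powr (- 2) \<le> 1 / (x * \<omega>)"
proof -
  let ?M = "Max {\<omega>, (Z * \<omega>) powr (2/3), Z * \<omega> powr (1/2)}"
  have le: "x * a \<le> w" if "a \<in> {\<omega>, (Z * \<omega>) powr (2/3), Z * \<omega> powr (1/2)}" for a
  proof -
    have "a \<le> ?M" using that by (intro Max_ge) auto
    then have "x * a \<le> x * ?M" using x by (intro mult_left_mono) auto
    then show ?thesis using w by linarith
  qed
  have w1: "w \<ge> x * \<omega>" and w2: "w \<ge> x * (Z * \<omega>) powr (2/3)" and w3: "w \<ge> x * (Z * \<omega> powr (1/2))"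
    by (rule le; simp)+
  have x1: "1 * \<omega> \<le> x * \<omega>" "x * 1 \<le> x * \<omega>" using x \<omega> by (intro mult_right_mono mult_left_mono; simp)+
  then show "w \<ge> x" using w1 by simp
  have "1 * (Z * 1) \<le> x * (Z * \<omega> powr (1/2))"
    using x Z \<omega> by (intro mult_mono mult_left_mono ge_one_powr_ge_zero) auto
  then show "w \<ge> Z" using w3 by simp
  have "x * \<omega> > 0" using x \<omega> by simp
  with w1 have pos: "x * \<omega> > 0" "w > 0" by linarith+
  show "w powr (- 1) \<le> 1 / (x * \<omega>)"
    using pos w1 by (simp add: powr_minus_divide frac_le)
  have xx: "x \<le> x powr (3/2)" using x powr_mono[of 1 "3/2" x] by simp
  have "Z * w powr (- (3/2)) \<le> Z * (x * (Z * \<omega>) powr (2/3)) powr (- (3/2))"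
    using w2 x Z \<omega> by (intro mult_left_mono powr_mono2') auto
  also have "\<dots> = Z * (x powr (- (3/2)) * (Z * \<omega>) powr (- 1))"
    using x Z \<omega> by (simp add: powr_mult powr_powr)
  also have "\<dots> = 1 / (x powr (3/2) * \<omega>)"
    using x Z \<omega> by (simp add: powr_minus_divide)
  also have "\<dots> \<le> 1 / (x * \<omega>)"
    using xx x pos \<omega> by (intro divide_left_mono mult_right_mono mult_pos_pos) auto
  finally show "Z * w powr (- (3/2)) \<le> 1 / (x * \<omega>)" .
  have "Z\<^sup>2 * w powr (- 2) \<le> Z\<^sup>2 * (x * (Z * \<omega> powr (1/2))) powr (- 2)"
    using w3 x Z \<omega> by (intro mult_left_mono powr_mono2') auto
  also have "(x * (Z * \<omega> powr (1/2))) powr (- 2) = 1 / (x * (Z * \<omega> powr (1/2)))\<^sup>2"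
    using x Z \<omega> by (simp add: powr_minus_divide)
  also have "(x * (Z * \<omega> powr (1/2)))\<^sup>2 = x\<^sup>2 * Z\<^sup>2 * \<omega>"
    using \<omega> by (simp add: power_mult_distrib powr_power)
  also have "Z\<^sup>2 * (1 / (x\<^sup>2 * Z\<^sup>2 * \<omega>)) = 1 / (x\<^sup>2 * \<omega>)" using Z by simp
  also have "\<dots> \<le> 1 / (x * \<omega>)"
    using x \<omega> pos mult_left_mono[of 1 x x]
    by (intro divide_left_mono mult_right_mono mult_pos_pos) (auto simp: power2_eq_square)
  finally show "Z\<^sup>2 * w powr (- 2) \<le> 1 / (x * \<omega>)" .
qed

theorem proposition2:
  fixes \<mu> :: "(complex^2^2) measure" and m :: nat and c :: real and \<xi> :: "nat \<Rightarrow> real"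
  assumes "haar_SU2 \<mu>"
    and "m \<in> {1, 2, 4}"
    and "moment_constant \<mu> m c"
    and "filterlim \<xi> at_top at_top"
  shows "\<forall>\<epsilon>>0. \<forall>\<^sub>F N in at_top. squarefree N \<longrightarrow> (\<forall>z::complex.
           P_minus N \<ge> ereal (\<xi> N * Max {real (omega N),
               ((norm z + 1) * real (omega N)) powr (2/3),
               (norm z + 1) * real (omega N) powr (1/2)}) \<and>
           z \<in> z_range c N \<longrightarrow>
           (\<exists>E::complex. norm E \<le> \<epsilon> \<and> L_level \<mu> m z N = L_limit \<mu> m z * (1 + E)))"
proof (intro allI impI)
  fix \<epsilon> :: real assume \<epsilon>: "\<epsilon> > 0"
  note haar = assms(1) and m = assms(2)
  obtain P0 C where C: "C \<ge> 0" "\<And>p z. P0 \<le> real p \<Longrightarrow> 1 + norm z \<le> real p \<Longrightarrow>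
     norm (local_int \<mu> m z p - 1)
       \<le> C * ((1 + norm z) * real p powr (- (3/2)) + (1 + norm z)\<^sup>2 * real p powr (- 2))"
    using local_int_approx[OF haar m] by blast
  define \<eta> where "\<eta> = min (1 / 2) (\<epsilon> / 4)"
  have \<eta>: "\<eta> > 0" "\<eta> \<le> 1 / 2" "4 * \<eta> \<le> \<epsilon>" using \<epsilon> by (auto simp: \<eta>_def)
  \<comment> \<open>\<open>exp(4/\<xi>) - 1\<close> will bound the deviation of \<open>X_factor\<close> from 1,
    \<open>exp(2C/\<xi>) - 1\<close> that of the product of local integrals.\<close>
  define K where "K = max 4 (2 * C)"
  have "((\<lambda>x. exp (K / x) - 1) \<longlongrightarrow> exp 0 - 1) at_top"
    by (intro tendsto_intros real_tendsto_divide_at_top[OF tendsto_const] filterlim_ident)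
  then have "\<forall>\<^sub>F x in at_top. exp (K / x) - 1 < \<eta>"
    using \<eta>(1) by (intro order_tendstoD(2)) auto
  then have "\<forall>\<^sub>F x in at_top. exp (K / x) - 1 < \<eta> \<and> x \<ge> max 1 P0"
    by (intro eventually_conj eventually_ge_at_top)
  then have "\<forall>\<^sub>F N in at_top. exp (K / \<xi> N) - 1 < \<eta> \<and> \<xi> N \<ge> max 1 P0"
    using assms(4) unfolding filterlim_iff by blast
  then have "\<forall>\<^sub>F N in at_top. (exp (K / \<xi> N) - 1 < \<eta> \<and> \<xi> N \<ge> max 1 P0) \<and> N > 0"
    by (rule eventually_conj[OF _ eventually_gt_at_top])
  then show "\<forall>\<^sub>F N in at_top. squarefree N \<longrightarrow> (\<forall>z::complex.
           P_minus N \<ge> ereal (\<xi> N * Max {real (omega N),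
               ((norm z + 1) * real (omega N)) powr (2/3),
               (norm z + 1) * real (omega N) powr (1/2)}) \<and>
           z \<in> z_range c N \<longrightarrow>
           (\<exists>E::complex. norm E \<le> \<epsilon> \<and> L_level \<mu> m z N = L_limit \<mu> m z * (1 + E)))"
  proof (eventually_elim, intro impI allI, elim conjE)
    fix N :: nat and z :: complex
    assume small: "exp (K / \<xi> N) - 1 < \<eta>" and \<xi>: "max 1 P0 \<le> \<xi> N" and N: "N > 0"
      and P: "ereal (\<xi> N * Max {real (omega N), ((norm z + 1) * real (omega N)) powr (2/3),
               (norm z + 1) * real (omega N) powr (1/2)}) \<le> P_minus N"
    define S where "S = prime_factors N"
    define \<omega> where "\<omega> = real (omega N)"
    define Z where "Z = 1 + norm z"
    define x where "x = \<xi> N"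
    have x: "x \<ge> 1" "x \<ge> P0" using \<xi> by (auto simp: x_def)
    have card: "real (card S) = \<omega>" by (simp add: \<omega>_def omega_def S_def)
    have bounds: "real p \<ge> P0 \<and> real p \<ge> Z \<and> real p powr (- 1) \<le> 1 / (x * \<omega>) \<and>
        Z * real p powr (- (3/2)) \<le> 1 / (x * \<omega>) \<and> Z\<^sup>2 * real p powr (- 2) \<le> 1 / (x * \<omega>)"
      if p: "p \<in> S" for p
    proof -
      have "card S > 0" using p by (auto simp: S_def card_gt_0_iff)
      then have "\<omega> \<ge> 1" using card by simp
      have "P_minus N \<le> ereal (real p)"
        unfolding P_minus_def using p by (intro INF_lower) (simp add: S_def)
      with P have "ereal (\<xi> N * Max {real (omega N), ((norm z + 1) * real (omega N)) powr (2/3),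
               (norm z + 1) * real (omega N) powr (1/2)}) \<le> ereal (real p)"
        by (rule order_trans)
      then have "real p \<ge> x * Max {\<omega>, (Z * \<omega>) powr (2/3), Z * \<omega> powr (1/2)}"
        by (simp only: ereal_less_eq x_def \<omega>_def Z_def add.commute[of 1])
      from prime_factor_terms_le[OF x(1) \<open>\<omega> \<ge> 1\<close> _ this] show ?thesis
        using x(2) by (auto simp: Z_def)
    qed
    have sum_le: "(\<Sum>p\<in>S. h p) \<le> 2 * B / x"
      if h: "\<And>p. p \<in> S \<Longrightarrow> h p \<le> B * (2 / (x * \<omega>))" and "B \<ge> 0" for h B
    proof -
      have "(\<Sum>p\<in>S. h p) \<le> (\<Sum>p\<in>S. B * (2 / (x * \<omega>)))" by (intro sum_mono h)
      also have "\<dots> = \<omega> * (B * (2 / (x * \<omega>)))" by (simp add: card)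
      also have "\<dots> \<le> 2 * B / x" using x \<open>B \<ge> 0\<close> by (cases "\<omega> = 0") (auto simp: mult.commute)
      finally show ?thesis .
    qed
    have exp_le: "exp (a / x) - 1 < \<eta>" if "a \<le> K" for a
    proof -
      have "exp (a / x) \<le> exp (K / x)" using that x by (simp add: divide_right_mono)
      then show ?thesis using small unfolding x_def by linarith
    qed
    define G where "G = (\<Prod>p\<in>S. local_int \<mu> m z p)"
    have X: "norm (X_factor m z N - 1) < \<eta>"
    proof -
      have "(\<Sum>p\<in>S. norm z * real p powr (- (3/2)) + real p powr (- 1)) \<le> 2 * 1 / x"
      proof (rule sum_le)
        fix p assume "p \<in> S"
        have "norm z * real p powr (- (3/2)) \<le> Z * real p powr (- (3/2))"
          by (intro mult_right_mono) (auto simp: Z_def)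
        then show "norm z * real p powr (- (3/2)) + real p powr (- 1) \<le> 1 * (2 / (x * \<omega>))"
          using bounds[OF \<open>p \<in> S\<close>] by (simp add: field_simps)
      qed simp
      then have "exp (2 * (\<Sum>p\<in>S. norm z * real p powr (- (3/2)) + real p powr (- 1))) - 1
          \<le> exp (4 / x) - 1" by simp
      also have "\<dots> < \<eta>" by (rule exp_le) (simp add: K_def)
      finally show ?thesis
        using norm_X_factor_minus_1_le_exp[of m z N] m by (auto simp: S_def)
    qed
    have G: "norm (G - 1) < \<eta>"
    proof -
      have "norm (G - 1) \<le> (\<Prod>p\<in>S. 1 + norm (local_int \<mu> m z p - 1)) - 1"
        using norm_prod_minus1_le_prod_minus1[of "\<lambda>p. local_int \<mu> m z p - 1" S] by (simp add: G_def)
      also have "\<dots> \<le> exp (\<Sum>p\<in>S. norm (local_int \<mu> m z p - 1)) - 1"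
        by (simp add: prod_le_exp_sum)
      also have "(\<Sum>p\<in>S. norm (local_int \<mu> m z p - 1)) \<le> 2 * C / x"
      proof (rule sum_le[OF _ C(1)])
        fix p assume "p \<in> S"
        note b = bounds[OF this]
        have "norm (local_int \<mu> m z p - 1) \<le> C * (Z * real p powr (- (3/2)) + Z\<^sup>2 * real p powr (- 2))"
          unfolding Z_def using b by (intro C(2)) (auto simp: Z_def)
        also have "\<dots> \<le> C * (1 / (x * \<omega>) + 1 / (x * \<omega>))"
          using b C(1) by (intro mult_left_mono add_mono) auto
        finally show "norm (local_int \<mu> m z p - 1) \<le> C * (2 / (x * \<omega>))"
          by (simp only: add_divide_distrib[symmetric] one_add_one)
      qed
      then have "exp (\<Sum>p\<in>S. norm (local_int \<mu> m z p - 1)) - 1 \<le> exp (2 * C / x) - 1" by simp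
      also have "\<dots> < \<eta>" by (rule exp_le) (simp add: K_def)
      finally show ?thesis .
    qed
    \<comment> \<open>The local integrals at the primes dividing \<open>N\<close> are moved to the denominator,
      so their product must stay away from 0.\<close>
    have G_ge: "norm G \<ge> 1 / 2"
      using norm_triangle_ineq2[of 1 "1 - G"] G \<eta>(2) by (simp add: norm_minus_commute)
    then have G0: "G \<noteq> 0" by auto
    obtain H where H: "L_level \<mu> m z N = X_factor m z N * H" "L_limit \<mu> m z = G * H"
      unfolding G_def S_def using L_level_eq[OF haar m N] by metis
    show "\<exists>E::complex. norm E \<le> \<epsilon> \<and> L_level \<mu> m z N = L_limit \<mu> m z * (1 + E)"
    proof (intro exI conjI)
      define E where "E = X_factor m z N / G - 1"
      show "L_level \<mu> m z N = L_limit \<mu> m z * (1 + E)"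
        unfolding H E_def using G0 by simp
      have "norm E = norm ((X_factor m z N - 1) - (G - 1)) / norm G"
        using G0 by (simp add: E_def divide_simps flip: norm_divide)
      also have "\<dots> \<le> (\<eta> + \<eta>) / (1 / 2)"
        using X G G_ge \<eta>(1) norm_triangle_ineq4[of "X_factor m z N - 1" "G - 1"]
        by (intro frac_le) auto
      also have "\<dots> \<le> \<epsilon>" using \<eta>(3) by simp
      finally show "norm E \<le> \<epsilon>" .
    qed
  qed
qed

end
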